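(* Let $\mathbf{n}=(n_1,\dots,n_N)\in\mathbb{N}^N$, $n=\sum_{k=1}^N n_k$, $0\le d\le\min_k n_k$, let $p^{(k)}\in\mathcal{P}_{n_k}$ be real polynomials and $w^{(k)}\in[0,+\infty)^{n_k+1}$ weight vectors, $k=1,\dots,N$. For a nonzero tuple $\widehat{\mathbf{g}}=(\widehat g^{(1)},\dots,\widehat g^{(N)})$ with $\widehat g^{(k)}\in\mathcal{P}_{n_k-d}$ such that the matrix obtained by stacking $\mathrm{diag}(\sqrt{w^{(k)}})\,\mathbf{M}_d(\widehat g^{(k)})$, $k=1,\dots,N$, vertically has full column rank, let $$f_2(\widehat{\mathbf{g}})=\min_{\widehat h\in\mathcal{P}_d}\ \sum_{k=1}^N\big\|\mathbf{M}_d(\widehat g^{(k)})\,\widehat h-p^{(k)}\big\|_{w^{(k)}}^2,$$ let $\widehat h_*$ be the minimizer, and let $g_*(\widehat{\mathbf{g}})$ be the vector obtained by stacking $\mathrm{diag}(\sqrt{w^{(k)}})\big(p^{(k)}-\mathbf{M}_d(\widehat g^{(k)})\widehat h_*\big)$, $k=1,\dots,N$ (so $f_2(\widehat{\mathbf{g}})=\|g_*(\widehat{\mathbf{g}})\|_2^2$). Then $f_2$, its gradient, the vector $g_*(\widehat{\mathbf{g}})$, and the Jacobian of $g_*$ with respect to $\widehat{\mathbf{g}}$ can be evaluated in $O((n-Nd)^2n)$ flops.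
   Context: $\mathcal{P}_m$ is the space of real polynomials of degree at most $m$, identified with coefficient vectors $[p_0\cdots p_m]^\top\in\mathbb{R}^{m+1}$. For $h\in\mathcal{P}_r$, $\mathbf{M}_m(h)\in\mathbb{R}^{(m+r+1)\times(m+1)}$ is the Toeplitz matrix with $(i,j)$ entry $h_{i-j}$ (zero if $i-j\notin\{0,\dots,r\}$), so $\mathbf{M}_m(h)q=h\cdot q$ for $q\in\mathcal{P}_m$. $\|y\|_w^2=\sum_jw_jy_j^2$. A flop is an elementary floating-point (real arithmetic) operation.
   Formalization: The constant in O is absolute when d < min n_k; for d ≤ min n_k it may depend on N. When n = Nd (all n_k = d), where the stated bound would be zero flops and is false, the bound is O(max(1,n)). *)

theory Defs
  imports
    Complex_Main
    "HOL-Library.Landau_Symbols"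
    "HOL-Computational_Algebra.Polynomial"
    "Jordan_Normal_Form.DL_Rank"
begin

section \<open>Straight-line programs over the reals\<close>

text \<open>
  One instruction is one flop. Copying and moving data is free, and so are integer literals; all other
  constants have to be computed. There are no branches, so the number of flops does not depend on
  the values of the inputs.
\<close>

datatype 'v operand = Input 'v | Const int | Reg nat

datatype 'v instr =
    Add "'v operand" "'v operand"
  | Sub "'v operand" "'v operand"
  | Mul "'v operand" "'v operand"
  | Div "'v operand" "'v operand"
  | Sqrt "'v operand"

fun operand_value :: "('v \<Rightarrow> real) \<Rightarrow> real list \<Rightarrow> 'v operand \<Rightarrow> real option" where
  "operand_value env regs (Input v) = Some (env v)"
| "operand_value env regs (Const c) = Some (of_int c)"
| "operand_value env regs (Reg i) = (if i < length regs then Some (regs ! i) else None)"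

definition lift2 :: "(real \<Rightarrow> real \<Rightarrow> real option) \<Rightarrow> real option \<Rightarrow> real option \<Rightarrow> real option" where
  "lift2 f x y = Option.bind x (\<lambda>a. Option.bind y (f a))"

text \<open>
  Division by zero and square roots of negative numbers abort the program. This keeps the HOL
  convention x / 0 = 0 from acting as a test for zero.
\<close>

fun instr_value :: "('v \<Rightarrow> real) \<Rightarrow> real list \<Rightarrow> 'v instr \<Rightarrow> real option" where
  "instr_value env regs (Add x y) =
     lift2 (\<lambda>a b. Some (a + b)) (operand_value env regs x) (operand_value env regs y)"
| "instr_value env regs (Sub x y) =
     lift2 (\<lambda>a b. Some (a - b)) (operand_value env regs x) (operand_value env regs y)"
| "instr_value env regs (Mul x y) =
     lift2 (\<lambda>a b. Some (a * b)) (operand_value env regs x) (operand_value env regs y)"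
| "instr_value env regs (Div x y) =
     lift2 (\<lambda>a b. if b = 0 then None else Some (a / b))
       (operand_value env regs x) (operand_value env regs y)"
| "instr_value env regs (Sqrt x) =
     Option.bind (operand_value env regs x) (\<lambda>a. if a < 0 then None else Some (sqrt a))"

text \<open>The i-th executed instruction writes register i.\<close>

fun run :: "('v \<Rightarrow> real) \<Rightarrow> 'v instr list \<Rightarrow> real list \<Rightarrow> real list option" where
  "run env [] regs = Some regs"
| "run env (c # cs) regs =
     Option.bind (instr_value env regs c) (\<lambda>x. run env cs (regs @ [x]))"

text \<open>The second component tells where each output is to be found after execution.\<close>

type_synonym ('v, 'o) slp = "'v instr list \<times> ('o \<Rightarrow> 'v operand)"

definition slp_output :: "('v, 'o) slp \<Rightarrow> ('v \<Rightarrow> real) \<Rightarrow> 'o \<Rightarrow> real option" where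
  "slp_output P env out = Option.bind (run env (fst P) []) (\<lambda>regs. operand_value env regs (snd P out))"

definition flops :: "('v, 'o) slp \<Rightarrow> nat" where
  "flops P = length (fst P)"


section \<open>The variable projection problem\<close>

text \<open>
  Tuples indexed by k = 1, \<dots>, N are lists of length N, indexed from 0. Throughout, ns is the
  list of the degrees n_k, and p, w, g are the lists of the polynomials p^(k), the weight vectors
  w^(k) and the polynomials g^(k).
\<close>

definition coeff_vec :: "nat \<Rightarrow> real poly \<Rightarrow> real vec" where
  "coeff_vec m q = vec (m + 1) (coeff q)"

text \<open>The (m + r + 1) x (m + 1) multiplication matrix of a polynomial h of degree at most r.\<close>

definition mult_mat :: "nat \<Rightarrow> nat \<Rightarrow> real poly \<Rightarrow> real mat" where
  "mult_mat m r h =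
     mat (m + r + 1) (m + 1) (\<lambda>(i, j). if j \<le> i \<and> i - j \<le> r then coeff h (i - j) else 0)"

definition wnorm2 :: "real vec \<Rightarrow> real vec \<Rightarrow> real" where
  "wnorm2 w y = (\<Sum>j<dim_vec y. w $ j * (y $ j)\<^sup>2)"

definition sqrt_diag :: "real vec \<Rightarrow> real mat" where
  "sqrt_diag w = mat_diag (dim_vec w) (\<lambda>i. sqrt (w $ i))"

definition stack_mats :: "nat \<Rightarrow> real mat list \<Rightarrow> real mat" where
  "stack_mats c As = mat_of_rows c (concat (map rows As))"

definition stack_vecs :: "real vec list \<Rightarrow> real vec" where
  "stack_vecs vs = vec_of_list (concat (map list_of_vec vs))"

definition stacked_matrix :: "nat list \<Rightarrow> nat \<Rightarrow> real vec list \<Rightarrow> real poly list \<Rightarrow> real mat" where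
  "stacked_matrix ns d w g =
     stack_mats (d + 1)
       (map (\<lambda>k. sqrt_diag (w ! k) * mult_mat d (ns ! k - d) (g ! k)) [0..<length ns])"

definition admissible_data :: "nat list \<Rightarrow> real poly list \<Rightarrow> real vec list \<Rightarrow> bool" where
  "admissible_data ns p w \<longleftrightarrow>
     length p = length ns \<and> length w = length ns \<and>
     (\<forall>k<length ns. degree (p ! k) \<le> ns ! k \<and>
        w ! k \<in> carrier_vec (ns ! k + 1) \<and> (\<forall>j<ns ! k + 1. 0 \<le> w ! k $ j))"

definition admissible_point :: "nat list \<Rightarrow> nat \<Rightarrow> real vec list \<Rightarrow> real poly list \<Rightarrow> bool" where
  "admissible_point ns d w g \<longleftrightarrow>
     length g = length ns \<and> (\<forall>k<length ns. degree (g ! k) \<le> ns ! k - d) \<and>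
     (\<exists>k<length ns. g ! k \<noteq> 0) \<and>
     vec_space.rank (dim_row (stacked_matrix ns d w g)) (stacked_matrix ns d w g)
       = dim_col (stacked_matrix ns d w g)"

definition objective ::
  "nat list \<Rightarrow> nat \<Rightarrow> real poly list \<Rightarrow> real vec list \<Rightarrow> real poly list \<Rightarrow> real poly \<Rightarrow> real" where
  "objective ns d p w g h =
     (\<Sum>k<length ns. wnorm2 (w ! k)
        (mult_mat d (ns ! k - d) (g ! k) *\<^sub>v coeff_vec d h - coeff_vec (ns ! k) (p ! k)))"

text \<open>LEAST on the linearly ordered reals denotes the minimum of the set of attained values.\<close>

definition f2 :: "nat list \<Rightarrow> nat \<Rightarrow> real poly list \<Rightarrow> real vec list \<Rightarrow> real poly list \<Rightarrow> real" where
  "f2 ns d p w g = (LEAST v. \<exists>h. degree h \<le> d \<and> v = objective ns d p w g h)"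

definition h_star ::
  "nat list \<Rightarrow> nat \<Rightarrow> real poly list \<Rightarrow> real vec list \<Rightarrow> real poly list \<Rightarrow> real poly" where
  "h_star ns d p w g = arg_min (objective ns d p w g) (\<lambda>h. degree h \<le> d)"

definition g_star ::
  "nat list \<Rightarrow> nat \<Rightarrow> real poly list \<Rightarrow> real vec list \<Rightarrow> real poly list \<Rightarrow> real vec" where
  "g_star ns d p w g =
     stack_vecs
       (map (\<lambda>k. sqrt_diag (w ! k) *\<^sub>v
               (coeff_vec (ns ! k) (p ! k)
                 - mult_mat d (ns ! k - d) (g ! k) *\<^sub>v coeff_vec d (h_star ns d p w g)))
         [0..<length ns])"


section \<open>Evaluation\<close>

text \<open>
  In the following two types, k is the position of a polynomial in its tuple, j is the position of
  a coefficient (or weight), and i is the position of an entry of the stacked vector.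
\<close>

datatype vp_input = In_p nat nat | In_w nat nat | In_g nat nat

datatype vp_output = Out_f2 | Out_grad nat nat | Out_gstar nat | Out_jac nat nat nat

fun input_env :: "real poly list \<Rightarrow> real vec list \<Rightarrow> real poly list \<Rightarrow> vp_input \<Rightarrow> real" where
  "input_env p w g (In_p k j) = coeff (p ! k) j"
| "input_env p w g (In_w k j) = w ! k $ j"
| "input_env p w g (In_g k j) = coeff (g ! k) j"

text \<open>Adds t to the coefficient of degree j of the k-th polynomial.\<close>

definition perturb :: "real poly list \<Rightarrow> nat \<Rightarrow> nat \<Rightarrow> real \<Rightarrow> real poly list" where
  "perturb g k j t = g[k := g ! k + monom t j]"

text \<open>
  Gradient and Jacobian are the arrays of partial derivatives with respect to the coefficients of
  the polynomials in g. The program has to be correct at every admissible point, without executing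
  an undefined operation.
\<close>

definition evaluates :: "nat list \<Rightarrow> nat \<Rightarrow> (vp_input, vp_output) slp \<Rightarrow> bool" where
  "evaluates ns d P \<longleftrightarrow>
     (\<forall>p w g. admissible_data ns p w \<longrightarrow> admissible_point ns d w g \<longrightarrow>
        slp_output P (input_env p w g) Out_f2 = Some (f2 ns d p w g) \<and>
        (\<forall>k<length ns. \<forall>j\<le>ns ! k - d. \<exists>D.
           slp_output P (input_env p w g) (Out_grad k j) = Some D \<and>
           ((\<lambda>t. f2 ns d p w (perturb g k j t)) has_real_derivative D) (at 0)) \<and>
        (\<forall>i<dim_vec (g_star ns d p w g).
           slp_output P (input_env p w g) (Out_gstar i) = Some (g_star ns d p w g $ i)) \<and>
        (\<forall>i<dim_vec (g_star ns d p w g). \<forall>k<length ns. \<forall>j\<le>ns ! k - d. \<exists>D.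
           slp_output P (input_env p w g) (Out_jac i k j) = Some D \<and>
           ((\<lambda>t. g_star ns d p w (perturb g k j t) $ i) has_real_derivative D) (at 0)))"

text \<open>The number n - N d, where n is the sum of the n_k.\<close>

definition excess :: "nat list \<Rightarrow> nat \<Rightarrow> real" where
  "excess ns d = real (sum_list ns) - real (length ns) * real d"

end

theory Submission
  imports Defs
begin

text \<open>
  For a fixed tuple g the inner problem is a weighted linear least squares problem for the d + 1
  coefficients of h, with the stacked multiplication matrix M and the diagonal matrix W of weights.
  Its solution x satisfies the normal equations A x = b, where A is the product of the transpose of M, of W and
  of M, and b that of the transpose of M, of W and of p. Let G be the number of coefficients of g, that is the
  sum of all n_k - d + 1. The program solves the normal equations. Three observations bound its cost.

  \<^item> The full column rank makes A positive definite. So elimination meets no zero pivot, and neither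
    pivoting nor branching is needed (\<open>positive_definite_imp_pivots_nonzero\<close>, \<open>vp_pivots_of_admissible\<close>).

  \<^item> M is sparse, however large d is: a row or a column of M has at most G nonzero entries, and A
    has bandwidth less than G. Elimination preserves the band, so R right-hand sides cost
    O((d + 1) (G^2 + G R)) flops (\<open>computes_elim_sol\<close>).

  \<^item> If M' is the derivative of M with respect to one coefficient of g, then differentiating the normal
    equations shows that the derivative x' of x solves a system with the same matrix A, whose right-hand side is
    given by M', M, W, x and the residual (\<open>lsq_sol_has_derivative\<close>). So all derivatives of x are found by one
    more elimination, with R = G. The Jacobian of the residual p - M x has the columns
    - (M' x + M x'), to be scaled by the square roots of the weights, and each of its entries costs O(G)
    flops since a row of M or M' has at most G nonzero entries.

  The stacked vector has n + N entries, and d + 1 does not exceed n + N, so g_star and its Jacobian are available after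
  O(G^2 (n + N)) flops; f2 is the squared norm of g_star and its gradient is twice the transposed Jacobian
  applied to g_star (\<open>computes_all\<close>, \<open>evaluates_in_flops\<close>). Finally G = (n - N d) + N. If d is less than
  all n_k, then N is at most n - N d and at most n; if N is fixed, it is a constant. Both asymptotic
  bounds follow.

  Cost is counted by the relation \<open>computes E F c G\<close>: a program that holds the quantities F can be extended
  by at most c instructions to hold also G.
\<close>

section \<open>Elimination without pivoting\<close>

text \<open>
  Eliminating the last unknown instead of the first leaves the remaining ones with indices
  below l, so recursion on the size of the system involves no index shift.
\<close>

definition schur :: "nat \<Rightarrow> (nat \<Rightarrow> nat \<Rightarrow> real) \<Rightarrow> nat \<Rightarrow> nat \<Rightarrow> real" where
  "schur l a i j = a i j - a i l * a l j / a l l"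

fun pivots_nonzero :: "nat \<Rightarrow> (nat \<Rightarrow> nat \<Rightarrow> real) \<Rightarrow> bool" where
  "pivots_nonzero 0 a \<longleftrightarrow> True"
| "pivots_nonzero (Suc l) a \<longleftrightarrow> a l l \<noteq> 0 \<and> pivots_nonzero l (schur l a)"

text \<open>
  The real function that the straight-line program evaluates. That it is an
  explicit composition of field operations is also what makes the solution differentiable in
  the data.
\<close>

fun elim_sol :: "nat \<Rightarrow> (nat \<Rightarrow> nat \<Rightarrow> real) \<Rightarrow> (nat \<Rightarrow> real) \<Rightarrow> nat \<Rightarrow> real" where
  "elim_sol 0 a b = (\<lambda>i. 0)"
| "elim_sol (Suc l) a b =
     (let x = elim_sol l (schur l a) (\<lambda>i. b i - a i l * b l / a l l)
      in x(l := (b l - (\<Sum>j<l. a l j * x j)) / a l l))"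

text \<open>
  Solving row l for the last unknown and substituting into row i: y is the value that the vector x
  gives to row l.
\<close>

lemma eliminate_last:
  assumes "a l l \<noteq> (0::real)" and "(\<Sum>j<Suc l. a l j * x j) = y"
  shows "(\<Sum>j<Suc l. a i j * x j) = (\<Sum>j<l. schur l a i j * x j) + a i l * y / a l l"
proof -
  have "x l = (y - (\<Sum>j<l. a l j * x j)) / a l l"
    using assms by (simp add: field_simps)
  then have "a i l * x l = a i l * y / a l l - (\<Sum>j<l. a i l * a l j / a l l * x j)"
    by (simp add: diff_divide_distrib right_diff_distrib sum_divide_distrib sum_distrib_left mult.assoc)
  then show ?thesis
    by (simp add: schur_def left_diff_distrib sum_subtractf)
qed

lemma elim_sol_iff:
  assumes "pivots_nonzero s a"
  shows "(\<forall>i<s. (\<Sum>j<s. a i j * x j) = b i) \<longleftrightarrow> (\<forall>i<s. x i = elim_sol s a b i)"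
  using assms
proof (induction s arbitrary: a b)
  case 0
  then show ?case by simp
next
  case (Suc l)
  let ?b = "\<lambda>i. b i - a i l * b l / a l l"
  have nz: "a l l \<noteq> 0" and IH: "(\<forall>i<l. (\<Sum>j<l. schur l a i j * x j) = ?b i)
      \<longleftrightarrow> (\<forall>i<l. x i = elim_sol l (schur l a) ?b i)"
    using Suc by simp_all
  have "(\<forall>i<Suc l. (\<Sum>j<Suc l. a i j * x j) = b i) \<longleftrightarrow>
     (\<forall>i<l. (\<Sum>j<l. schur l a i j * x j) = ?b i) \<and> (\<Sum>j<Suc l. a l j * x j) = b l"
  proof -
    have "(\<Sum>j<Suc l. a i j * x j) = b i \<longleftrightarrow> (\<Sum>j<l. schur l a i j * x j) = ?b i"
      if "(\<Sum>j<Suc l. a l j * x j) = b l" for i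
      using eliminate_last[of a l x "b l" i, OF nz that] by linarith
    then show ?thesis
      unfolding less_Suc_eq by blast
  qed
  also have "(\<Sum>j<Suc l. a l j * x j) = b l \<longleftrightarrow> x l = (b l - (\<Sum>j<l. a l j * x j)) / a l l"
    using nz by (auto simp: field_simps)
  also have "(\<forall>i<l. (\<Sum>j<l. schur l a i j * x j) = ?b i) \<and>
      x l = (b l - (\<Sum>j<l. a l j * x j)) / a l l
    \<longleftrightarrow> (\<forall>i<Suc l. x i = elim_sol (Suc l) a b i)"
    unfolding IH by (auto simp: less_Suc_eq Let_def)
  finally show ?case .
qed

lemma elim_sol_solves:
  assumes "pivots_nonzero s a" "i < s"
  shows "(\<Sum>j<s. a i j * elim_sol s a b j) = b i"
  using elim_sol_iff[OF assms(1), of "elim_sol s a b" b] assms(2) by simp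

lemma elim_sol_unique:
  assumes "pivots_nonzero s a" "\<And>i. i < s \<Longrightarrow> (\<Sum>j<s. a i j * x j) = b i" "i < s"
  shows "x i = elim_sol s a b i"
  using elim_sol_iff[OF assms(1), of x b] assms(2,3) by simp

text \<open>
  The pivot is a value of the quadratic form at a unit vector, and the quadratic form of the Schur
  complement at x is the quadratic form of a at an extension of x, so that definiteness is inherited.
\<close>

lemma positive_definite_imp_pivots_nonzero:
  assumes "\<And>x. \<exists>i<s. x i \<noteq> 0 \<Longrightarrow> (\<Sum>i<s. x i * (\<Sum>j<s. a i j * x j)) > 0"
  shows "pivots_nonzero s a"
  using assms
proof (induction s arbitrary: a)
  case 0
  then show ?case by simp
next
  case (Suc l)
  have "(\<Sum>i<Suc l. (if i = l then 1 else 0) * (\<Sum>j<Suc l. a i j * (if j = l then 1 else 0))) > 0"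
    by (rule Suc.prems) auto
  then have nz: "a l l \<noteq> 0"
    by simp
  have "(\<Sum>i<l. x i * (\<Sum>j<l. schur l a i j * x j)) > 0" if "\<exists>i<l. x i \<noteq> 0" for x
  proof -
    \<comment> \<open>The last entry is chosen such that row l of a annihilates the extended vector.\<close>
    define z where "z = x(l := - (\<Sum>j<l. a l j * x j) / a l l)"
    have row: "(\<Sum>j<Suc l. a l j * z j) = 0"
      using nz by (simp add: z_def)
    have "(\<Sum>i<Suc l. z i * (\<Sum>j<Suc l. a i j * z j)) > 0"
      using that by (intro Suc.prems) (auto simp: z_def less_Suc_eq)
    also have "(\<Sum>i<Suc l. z i * (\<Sum>j<Suc l. a i j * z j))
        = (\<Sum>i<Suc l. z i * (\<Sum>j<l. schur l a i j * z j))"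
      using eliminate_last[of a l z 0, OF nz row] by simp
    also have "\<dots> = (\<Sum>i<l. x i * (\<Sum>j<l. schur l a i j * x j))"
      using nz by (simp add: z_def schur_def)
    finally show ?thesis .
  qed
  then have "pivots_nonzero l (schur l a)"
    by (rule Suc.IH)
  with nz show ?case by simp
qed

lemma schur_differentiable:
  assumes "\<And>i j. i < Suc l \<Longrightarrow> j < Suc l \<Longrightarrow> (\<lambda>t. a t i j) differentiable (at (t0::real))"
    and "a t0 l l \<noteq> 0" "i < l" "j < l"
  shows "(\<lambda>t. schur l (a t) i j) differentiable (at t0)"
  unfolding schur_def using assms(2-4)
  by (intro differentiable_diff differentiable_divide differentiable_mult assms(1)) auto

text \<open>
  Pivots are continuous in the entries as long as the earlier pivots do not vanish. This keeps the
  least squares problem uniquely solvable for small perturbations of its matrix.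
\<close>

lemma eventually_pivots_nonzero:
  assumes "\<And>i j. i < s \<Longrightarrow> j < s \<Longrightarrow> (\<lambda>t. a t i j) differentiable (at (t0::real))"
    and "pivots_nonzero s (a t0)"
  shows "\<forall>\<^sub>F t in nhds t0. pivots_nonzero s (a t)"
  using assms
proof (induction s arbitrary: a)
  case 0
  then show ?case by simp
next
  case (Suc l)
  have nz: "a t0 l l \<noteq> 0" and piv: "pivots_nonzero l (schur l (a t0))"
    using Suc.prems by simp_all
  have "((\<lambda>t. a t l l) \<longlongrightarrow> a t0 l l) (nhds t0)"
    using Suc.prems(1)[of l l]
    unfolding tendsto_at_iff_tendsto_nhds[where g = "\<lambda>t. a t l l", symmetric]
    by (auto simp: differentiable_def dest!: has_derivative_continuous continuous_within[THEN iffD1])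
  then have "\<forall>\<^sub>F t in nhds t0. a t l l \<noteq> 0"
    using nz by (rule tendsto_imp_eventually_ne)
  moreover have "\<forall>\<^sub>F t in nhds t0. pivots_nonzero l (schur l (a t))"
    by (rule Suc.IH[of "\<lambda>t. schur l (a t)", OF _ piv]) (rule schur_differentiable[of l a t0, OF Suc.prems(1) nz])
  ultimately show ?case
    by eventually_elim simp
qed

lemma elim_sol_differentiable:
  assumes "\<And>i j. i < s \<Longrightarrow> j < s \<Longrightarrow> (\<lambda>t. a t i j) differentiable (at (t0::real))"
    and "\<And>i. i < s \<Longrightarrow> (\<lambda>t. b t i) differentiable (at t0)"
    and "pivots_nonzero s (a t0)" "i < s"
  shows "(\<lambda>t. elim_sol s (a t) (b t) i) differentiable (at t0)"
  using assms
proof (induction s arbitrary: a b i)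
  case 0
  then show ?case by simp
next
  case (Suc l)
  have nz: "a t0 l l \<noteq> 0" and piv: "pivots_nonzero l (schur l (a t0))"
    using Suc.prems by simp_all
  have x: "(\<lambda>t. elim_sol l (schur l (a t)) (\<lambda>i. b t i - a t i l * b t l / a t l l) j)
      differentiable (at t0)" if "j < l" for j
    using that nz
    by (intro Suc.IH[of "\<lambda>t. schur l (a t)", OF schur_differentiable[of l a t0, OF Suc.prems(1) nz] _ piv]
        differentiable_diff differentiable_divide differentiable_mult Suc.prems(1,2)) auto
  show ?case
  proof (cases "i = l")
    case True
    then show ?thesis
      using nz by (auto simp: Let_def
        intro!: differentiable_diff differentiable_divide differentiable_mult differentiable_sum x Suc.prems(1,2))
  next
    case False
    then show ?thesis
      using x Suc.prems(4) by (simp add: Let_def)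
  qed
qed

section \<open>Counting flops of straight-line programs\<close>

text \<open>
  An aborting program holds nothing. So when a program is extended from the empty set of quantities,
  it has to be required separately that it runs to completion.
\<close>

definition safe :: "('v \<Rightarrow> real) set \<Rightarrow> 'v instr list \<Rightarrow> bool" where
  "safe E cs \<longleftrightarrow> (\<forall>e\<in>E. run e cs [] \<noteq> None)"

text \<open>
  Quantities are functions of the inputs, and a program holds such a function if one and the same
  operand carries its value for all inputs in E.
\<close>

definition held :: "('v \<Rightarrow> real) set \<Rightarrow> 'v instr list \<Rightarrow> (('v \<Rightarrow> real) \<Rightarrow> real) set" where
  "held E cs = {f. \<exists>x. \<forall>e\<in>E. Option.bind (run e cs []) (\<lambda>regs. operand_value e regs x) = Some (f e)}"

text \<open>
  Quantifying over all programs cs that already hold F makes the costs additive: program fragments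
  are composed without any bookkeeping of register numbers.
\<close>

definition computes ::
  "('v \<Rightarrow> real) set \<Rightarrow> (('v \<Rightarrow> real) \<Rightarrow> real) set \<Rightarrow> nat \<Rightarrow> (('v \<Rightarrow> real) \<Rightarrow> real) set \<Rightarrow> bool" where
  "computes E F c G \<longleftrightarrow>
     (\<forall>cs. safe E cs \<longrightarrow> F \<subseteq> held E cs \<longrightarrow>
        (\<exists>ds. length ds \<le> c \<and> safe E (cs @ ds) \<and> held E cs \<union> G \<subseteq> held E (cs @ ds)))"

lemma run_append: "run e (cs @ ds) regs = Option.bind (run e cs regs) (run e ds)"
  by (induction cs arbitrary: regs) auto

lemma run_length: "run e cs regs = Some regs' \<Longrightarrow> length regs' = length regs + length cs"
  by (induction cs arbitrary: regs) (fastforce split: Option.bind_splits)+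

lemma operand_value_append:
  "operand_value e regs x = Some y \<Longrightarrow> operand_value e (regs @ regs') x = Some y"
  by (cases x) (auto simp: nth_append split: if_splits)

lemma held_step:
  assumes "safe E cs"
    and c: "\<And>e regs. e \<in> E \<Longrightarrow> run e cs [] = Some regs \<Longrightarrow> instr_value e regs c = Some (f e)"
  shows "safe E (cs @ [c]) \<and> insert f (held E cs) \<subseteq> held E (cs @ [c])"
proof -
  have run: "\<exists>regs. run e cs [] = Some regs \<and> length regs = length cs
      \<and> run e (cs @ [c]) [] = Some (regs @ [f e])" if "e \<in> E" for e
    using assms that run_length[of e cs "[]"] by (fastforce simp: safe_def run_append)
  have "f \<in> held E (cs @ [c])"
    using run by (fastforce simp: held_def nth_append intro!: exI[of _ "Reg (length cs)"])
  moreover have "g \<in> held E (cs @ [c])" if g: "g \<in> held E cs" for g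
  proof -
    obtain x where x: "Option.bind (run e cs []) (\<lambda>regs. operand_value e regs x) = Some (g e)"
      if "e \<in> E" for e
      using g by (auto simp: held_def)
    have "Option.bind (run e (cs @ [c]) []) (\<lambda>regs. operand_value e regs x) = Some (g e)"
      if "e \<in> E" for e
      using run[OF that] x[OF that] operand_value_append by fastforce
    then show ?thesis
      by (auto simp: held_def)
  qed
  ultimately show ?thesis
    using run by (fastforce simp: safe_def)
qed

lemma held_cong:
  assumes "f \<in> held E cs" "\<And>e. e \<in> E \<Longrightarrow> f e = g e"
  shows "g \<in> held E cs"
  using assms by (auto simp: held_def)

lemma held_Input: "safe E cs \<Longrightarrow> (\<lambda>e. e v) \<in> held E cs"
  by (fastforce simp: safe_def held_def intro!: exI[of _ "Input v"])

lemma held_Const: "safe E cs \<Longrightarrow> (\<lambda>e. of_int c) \<in> held E cs"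
  by (fastforce simp: safe_def held_def intro!: exI[of _ "Const c"])

lemma computes_mem: "G \<subseteq> F \<Longrightarrow> computes E F c G"
  unfolding computes_def by (intro allI impI exI[of _ "[]"]) auto

lemma computes_mono:
  "computes E F c G \<Longrightarrow> F \<subseteq> F' \<Longrightarrow> c \<le> c' \<Longrightarrow> G' \<subseteq> G \<Longrightarrow> computes E F' c' G'"
  unfolding computes_def by (meson order_trans le_sup_iff order_refl sup_mono)

lemma computes_trans:
  assumes "computes E F c G" "computes E (F \<union> G) c' H"
  shows "computes E F (c + c') (G \<union> H)"
  unfolding computes_def
proof (intro allI impI)
  fix cs assume cs: "safe E cs" "F \<subseteq> held E cs"
  obtain ds where ds: "length ds \<le> c" "safe E (cs @ ds)" "held E cs \<union> G \<subseteq> held E (cs @ ds)"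
    using assms(1) cs unfolding computes_def by blast
  have "F \<union> G \<subseteq> held E (cs @ ds)"
    using cs(2) ds(3) by blast
  then obtain ds' where ds': "length ds' \<le> c'" "safe E ((cs @ ds) @ ds')"
      "held E (cs @ ds) \<union> H \<subseteq> held E ((cs @ ds) @ ds')"
    using assms(2) ds(2) unfolding computes_def by blast
  show "\<exists>ds. length ds \<le> c + c' \<and> safe E (cs @ ds) \<and> held E cs \<union> (G \<union> H) \<subseteq> held E (cs @ ds)"
    using ds ds' by (intro exI[of _ "ds @ ds'"]) auto
qed

lemma computes_cong:
  assumes "computes E F c {f}" "\<And>e. e \<in> E \<Longrightarrow> f e = g e"
  shows "computes E F c {g}"
  unfolding computes_def
proof (intro allI impI)
  fix cs assume "safe E cs" "F \<subseteq> held E cs"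
  then obtain ds where "length ds \<le> c" "safe E (cs @ ds)" "held E cs \<union> {f} \<subseteq> held E (cs @ ds)"
    using assms(1) unfolding computes_def by blast
  then show "\<exists>ds. length ds \<le> c \<and> safe E (cs @ ds) \<and> held E cs \<union> {g} \<subseteq> held E (cs @ ds)"
    using held_cong[of f E _ g] assms(2) by (intro exI[of _ ds]) auto
qed

lemma computes_Un:
  "computes E F c G \<Longrightarrow> computes E F c' H \<Longrightarrow> computes E F (c + c') (G \<union> H)"
  by (rule computes_trans) (auto intro: computes_mono)

lemma computes_UN:
  assumes "finite I" "\<And>i. i \<in> I \<Longrightarrow> computes E F c (G i)"
  shows "computes E F (card I * c) (\<Union>i\<in>I. G i)"
  using assms
proof (induction I)
  case empty
  then show ?case by (simp add: computes_mem)
next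
  case (insert a I)
  then have "computes E F (c + card I * c) (G a \<union> (\<Union>i\<in>I. G i))"
    by (intro computes_Un) auto
  then show ?case
    using insert by simp
qed

lemma computes_image:
  assumes "finite I" "\<And>i. i \<in> I \<Longrightarrow> computes E F c {f i}"
  shows "computes E F (card I * c) (f ` I)"
  using computes_UN[of I E F c "\<lambda>i. {f i}", OF assms] by (simp add: UNION_singleton_eq_range)

lemma computes_Input: "computes E F c {\<lambda>e. e v}"
  unfolding computes_def by (intro allI impI exI[of _ "[]"]) (auto simp: held_Input)

lemma computes_Const: "computes E F c {\<lambda>e. of_int a}"
  unfolding computes_def by (intro allI impI exI[of _ "[]"]) (auto simp: held_Const)

lemma computes_zero: "computes E F c {\<lambda>e. 0}"
  using computes_Const[of E F c 0] by simp

lemma computes_instr2: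
  assumes "computes E F c {f}" "computes E F c' {g}"
    and instr: "\<And>e regs x y. e \<in> E \<Longrightarrow> operand_value e regs x = Some (f e) \<Longrightarrow>
       operand_value e regs y = Some (g e) \<Longrightarrow> instr_value e regs (op x y) = Some (h e)"
  shows "computes E F (c + c' + 1) {h}"
proof -
  have "computes E (F \<union> ({f} \<union> {g})) 1 {h}"
    unfolding computes_def
  proof (intro allI impI)
    fix cs assume cs: "safe E cs" and "F \<union> ({f} \<union> {g}) \<subseteq> held E cs"
    then have "f \<in> held E cs" "g \<in> held E cs"
      by auto
    then obtain x y where xy: "\<And>e. e \<in> E \<Longrightarrow>
        Option.bind (run e cs []) (\<lambda>regs. operand_value e regs x) = Some (f e) \<and>
        Option.bind (run e cs []) (\<lambda>regs. operand_value e regs y) = Some (g e)"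
      unfolding held_def by blast
    have "safe E (cs @ [op x y]) \<and> insert h (held E cs) \<subseteq> held E (cs @ [op x y])"
      by (rule held_step[OF cs]) (use xy instr in fastforce)
    then show "\<exists>ds. length ds \<le> 1 \<and> safe E (cs @ ds) \<and> held E cs \<union> {h} \<subseteq> held E (cs @ ds)"
      by (intro exI[of _ "[op x y]"]) auto
  qed
  from computes_trans[OF computes_Un[OF assms(1,2)] this] show ?thesis
    by (rule computes_mono) auto
qed

lemma computes_add:
  "computes E F c {f} \<Longrightarrow> computes E F c' {g} \<Longrightarrow> computes E F (c + c' + 1) {\<lambda>e. f e + g e}"
  by (rule computes_instr2[where op = Add]) (auto simp: lift2_def)

lemma computes_diff:
  "computes E F c {f} \<Longrightarrow> computes E F c' {g} \<Longrightarrow> computes E F (c + c' + 1) {\<lambda>e. f e - g e}"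
  by (rule computes_instr2[where op = Sub]) (auto simp: lift2_def)

lemma computes_mult:
  "computes E F c {f} \<Longrightarrow> computes E F c' {g} \<Longrightarrow> computes E F (c + c' + 1) {\<lambda>e. f e * g e}"
  by (rule computes_instr2[where op = Mul]) (auto simp: lift2_def)

lemma computes_divide:
  "computes E F c {f} \<Longrightarrow> computes E F c' {g} \<Longrightarrow> (\<And>e. e \<in> E \<Longrightarrow> g e \<noteq> 0) \<Longrightarrow>
   computes E F (c + c' + 1) {\<lambda>e. f e / g e}"
  by (rule computes_instr2[where op = Div]) (auto simp: lift2_def)

lemma computes_sqrt:
  assumes "computes E F c {f}" "\<And>e. e \<in> E \<Longrightarrow> f e \<ge> 0"
  shows "computes E F (c + 1) {\<lambda>e. sqrt (f e)}"
proof -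
  have "computes E F (c + 0 + 1) {\<lambda>e. sqrt (f e)}"
    by (rule computes_instr2[where op = "\<lambda>x y. Sqrt x", OF assms(1) computes_zero])
      (use assms(2) in fastforce)
  then show ?thesis by simp
qed

lemma computes_sum:
  assumes "finite I" "\<And>i. i \<in> I \<Longrightarrow> computes E F c {f i}"
  shows "computes E F (card I * (c + 1)) {\<lambda>e. \<Sum>i\<in>I. f i e}"
  using assms
proof (induction I)
  case empty
  then show ?case by (simp add: computes_zero)
next
  case (insert a I)
  then have "computes E F (c + card I * (c + 1) + 1) {\<lambda>e. f a e + (\<Sum>i\<in>I. f i e)}"
    by (intro computes_add) auto
  then show ?case
    using insert by (simp add: algebra_simps)
qed

text \<open>
  Entries that are known to be available for free, in practice those outside a band, do not count.
\<close>

lemma computes_image_support: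
  assumes "finite I" "J \<subseteq> I" "\<And>i. i \<in> J \<Longrightarrow> computes E F c {f i}"
    and "\<And>i. i \<in> I - J \<Longrightarrow> computes E F 0 {f i}"
  shows "computes E F (card J * c) (f ` I)"
proof -
  have "computes E F (card J * c + card (I - J) * 0) (f ` J \<union> f ` (I - J))"
    using assms by (intro computes_Un computes_image) (auto intro: finite_subset)
  then show ?thesis
    by (rule computes_mono) (use assms(2) in auto)
qed

lemma computes_sum_support:
  assumes "finite I" "J \<subseteq> I" "\<And>i. i \<in> J \<Longrightarrow> computes E F c {f i}"
    and "\<And>i e. i \<in> I - J \<Longrightarrow> e \<in> E \<Longrightarrow> f i e = 0"
  shows "computes E F (card J * (c + 1)) {\<lambda>e. \<Sum>i\<in>I. f i e}"
proof (rule computes_cong)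
  show "computes E F (card J * (c + 1)) {\<lambda>e. \<Sum>i\<in>J. f i e}"
    using assms by (intro computes_sum) (auto intro: finite_subset)
  show "(\<Sum>i\<in>J. f i e) = (\<Sum>i\<in>I. f i e)" if "e \<in> E" for e
    using assms that by (intro sum.mono_neutral_left) auto
qed

text \<open>
  The step from the calculus back to an actual program: the choice of operands becomes the map that
  tells where the outputs are found.
\<close>

lemma slp_of_computes:
  assumes "computes E {} c (range f)"
  obtains P :: "('v, 'o) slp" where "flops P \<le> c"
    "\<And>e out. e \<in> E \<Longrightarrow> slp_output P e out = Some (f out e)"
proof -
  have "safe E []"
    by (simp add: safe_def)
  then obtain cs where cs: "length cs \<le> c" "range f \<subseteq> held E cs"
    using assms unfolding computes_def by fastforce
  then have "\<forall>out. \<exists>x. \<forall>e\<in>E. Option.bind (run e cs []) (\<lambda>regs. operand_value e regs x) = Some (f out e)"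
    by (auto simp: held_def)
  then obtain r where "\<And>out e. e \<in> E \<Longrightarrow>
      Option.bind (run e cs []) (\<lambda>regs. operand_value e regs (r out)) = Some (f out e)"
    by metis
  then show ?thesis
    using cs(1) by (intro that[of "(cs, r)"]) (simp_all add: flops_def slp_output_def)
qed

section \<open>Flops of banded elimination\<close>

text \<open>
  In a matrix of bandwidth \<beta> only the \<beta> rows above the last one have a nonzero entry in the last column.
  Hence one elimination step updates at most \<beta>^2 matrix entries and \<beta> entries of each right-hand side,
  and the back substitution for one unknown is a sum of at most \<beta> products. The Schur complement has
  the same bandwidth, since both rows and columns that it changes lie within \<beta> of the eliminated one.
\<close>

lemma computes_elim_sol:
  fixes a :: "('v \<Rightarrow> real) \<Rightarrow> nat \<Rightarrow> nat \<Rightarrow> real" and b :: "('v \<Rightarrow> real) \<Rightarrow> 'r \<Rightarrow> nat \<Rightarrow> real"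
  assumes "finite R"
    and "\<And>e i j. e \<in> E \<Longrightarrow> i < s \<Longrightarrow> j < s \<Longrightarrow> a e i j \<noteq> 0 \<Longrightarrow> i < j + \<beta> \<and> j < i + \<beta>"
    and "\<And>e. e \<in> E \<Longrightarrow> pivots_nonzero s (a e)"
    and "\<And>i j. i < s \<Longrightarrow> j < s \<Longrightarrow> (\<lambda>e. a e i j) \<in> F"
    and "\<And>i r. i < s \<Longrightarrow> r \<in> R \<Longrightarrow> (\<lambda>e. b e r i) \<in> F"
  shows "computes E F (s * (3 * \<beta>\<^sup>2 + 5 * \<beta> * card R + 2 * card R))
    ((\<lambda>(i, r) e. elim_sol s (a e) (b e r) i) ` ({..<s} \<times> R))"
  using assms(2-)
proof (induction s arbitrary: a b F)
  case 0
  then show ?case by (simp add: computes_mem)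
next
  case (Suc l)
  let ?c = "3 * \<beta>\<^sup>2 + 5 * \<beta> * card R + 2 * card R"
  note band = Suc.prems(1) and a_in = Suc.prems(3) and b_in = Suc.prems(4)
  have nz: "a e l l \<noteq> 0" and piv: "pivots_nonzero l (schur l (a e))" if "e \<in> E" for e
    using Suc.prems(2)[OF that] by simp_all
  \<comment> \<open>The only rows and columns that eliminating the last unknown changes.\<close>
  define W where "W = {i. i < l \<and> l < i + \<beta>}"
  have W: "W \<subseteq> {..<l}" "finite W"
    by (auto simp: W_def)
  have "W \<subseteq> {l + 1 - \<beta>..<l}"
    by (auto simp: W_def)
  then have card_W: "card W \<le> \<beta>"
    using card_mono[of "{l + 1 - \<beta>..<l}" W] by simp
  have col_zero: "a e i l = 0" and row_zero: "a e l i = 0" if "e \<in> E" "i < l" "i \<notin> W" for e i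
    using band[of e i l] band[of e l i] that by (auto simp: W_def)
  define b' where "b' e r i = b e r i - a e i l * b e r l / a e l l" for e r i
  define A' where "A' = (\<lambda>(i, j) e. schur l (a e) i j) ` ({..<l} \<times> {..<l})"
  define B' where "B' = (\<lambda>(i, r) e. b' e r i) ` ({..<l} \<times> R)"
  define X' where "X' = (\<lambda>(i, r) e. elim_sol l (schur l (a e)) (b' e r) i) ` ({..<l} \<times> R)"
  have mem: "computes E F' 0 {\<lambda>e. a e i j}" if "i < Suc l" "j < Suc l" "F \<subseteq> F'" for i j F'
    using a_in[OF that(1,2)] that(3) by (intro computes_mem) auto
  have memb: "computes E F' 0 {\<lambda>e. b e r i}" if "i < Suc l" "r \<in> R" "F \<subseteq> F'" for i r F'
    using b_in[OF that(1,2)] that(3) by (intro computes_mem) auto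
  have cost_A: "computes E F (card (W \<times> W) * 3) A'"
    unfolding A'_def
  proof (rule computes_image_support)
    show "computes E F 3 {(\<lambda>(i, j) e. schur l (a e) i j) ij}" if "ij \<in> W \<times> W" for ij
    proof -
      \<comment> \<open>The count mirrors the expression: 0 for a held operand, 1 for an operation.\<close>
      have "computes E F (0 + (0 + 0 + 1 + 0 + 1) + 1) {\<lambda>e. a e i j - a e i l * a e l j / a e l l}"
        if "i < l" "j < l" for i j
        using that by (intro computes_diff computes_divide computes_mult mem nz) auto
      then show ?thesis
        using that W(1) by (auto simp: schur_def numeral_eq_Suc)
    qed
    show "computes E F 0 {(\<lambda>(i, j) e. schur l (a e) i j) ij}"
      if ij: "ij \<in> {..<l} \<times> {..<l} - W \<times> W" for ij
    proof -
      obtain i j where "ij = (i, j)" "i < l" "j < l" "i \<notin> W \<or> j \<notin> W"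
        using ij by blast
      then show ?thesis
        using computes_cong[OF mem[of i j F], of "\<lambda>e. schur l (a e) i j"]
        by (force simp: schur_def col_zero row_zero)
    qed
  qed (use W in auto)
  have cost_B: "computes E F (card (W \<times> R) * 3) B'"
    unfolding B'_def
  proof (rule computes_image_support)
    show "computes E F 3 {(\<lambda>(i, r) e. b' e r i) ir}" if "ir \<in> W \<times> R" for ir
    proof -
      have "computes E F (0 + (0 + 0 + 1 + 0 + 1) + 1) {\<lambda>e. b e r i - a e i l * b e r l / a e l l}"
        if "i < l" "r \<in> R" for i r
        using that by (intro computes_diff computes_divide computes_mult mem memb nz) auto
      then show ?thesis
        using that W(1) by (auto simp: b'_def numeral_eq_Suc)
    qed
    show "computes E F 0 {(\<lambda>(i, r) e. b' e r i) ir}" if ir: "ir \<in> {..<l} \<times> R - W \<times> R" for ir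
    proof -
      obtain i r where "ir = (i, r)" "i < l" "i \<notin> W" "r \<in> R"
        using ir by auto
      then show ?thesis
        using computes_cong[OF memb[of i r F], of "\<lambda>e. b' e r i"]
        by (auto simp: b'_def col_zero)
    qed
  qed (use W assms(1) in auto)
  have cost_X': "computes E (F \<union> (A' \<union> B')) (l * ?c) X'"
    unfolding X'_def
  proof (rule Suc.IH)
    show "i < j + \<beta> \<and> j < i + \<beta>"
      if "e \<in> E" "i < l" "j < l" "schur l (a e) i j \<noteq> 0" for e i j
    proof (cases "a e i j = 0")
      case True
      then have "a e i l \<noteq> 0" "a e l j \<noteq> 0"
        using that(4) by (auto simp: schur_def)
      then show ?thesis
        using band[of e i l] band[of e l j] that by auto
    qed (use band[of e i j] that in auto)
  qed (auto simp: A'_def B'_def piv)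
  have cost_x: "computes E (F \<union> (A' \<union> B') \<union> X') (card R * (2 * \<beta> + 2))
      ((\<lambda>r e. (b e r l - (\<Sum>j<l. a e l j * elim_sol l (schur l (a e)) (b' e r) j)) / a e l l) ` R)"
  proof (rule computes_image[OF assms(1)])
    fix r assume r: "r \<in> R"
    have "computes E (F \<union> (A' \<union> B') \<union> X') (0 + card W * ((0 + 0 + 1) + 1) + 1 + 0 + 1)
      {\<lambda>e. (b e r l - (\<Sum>j<l. a e l j * elim_sol l (schur l (a e)) (b' e r) j)) / a e l l}"
    proof (intro computes_divide computes_diff computes_sum_support computes_mult mem memb nz)
      show "computes E (F \<union> (A' \<union> B') \<union> X') 0 {\<lambda>e. elim_sol l (schur l (a e)) (b' e r) j}"
        if "j \<in> W" for j
        using that r W(1) by (intro computes_mem) (auto simp: X'_def)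
    qed (use W r row_zero in auto)
    then show "computes E (F \<union> (A' \<union> B') \<union> X') (2 * \<beta> + 2)
      {\<lambda>e. (b e r l - (\<Sum>j<l. a e l j * elim_sol l (schur l (a e)) (b' e r) j)) / a e l l}"
      by (rule computes_mono) (use card_W in auto)
  qed
  have "computes E F (card (W \<times> W) * 3 + card (W \<times> R) * 3 + (l * ?c + card R * (2 * \<beta> + 2)))
     (A' \<union> B' \<union> (X' \<union>
      (\<lambda>r e. (b e r l - (\<Sum>j<l. a e l j * elim_sol l (schur l (a e)) (b' e r) j)) / a e l l) ` R))"
    by (intro computes_trans[OF computes_Un[OF cost_A cost_B]] computes_trans[OF cost_X' cost_x])
  then show ?case
  proof (rule computes_mono)
    have "card W * card W \<le> \<beta> * \<beta>" "card W * card R \<le> \<beta> * card R"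
      using card_W by (intro mult_le_mono; simp)+
    then show "card (W \<times> W) * 3 + card (W \<times> R) * 3 + (l * ?c + card R * (2 * \<beta> + 2)) \<le> Suc l * ?c"
      by (simp only: card_cartesian_product power2_eq_square mult_Suc distrib_left distrib_right
          mult_ac)
    show "(\<lambda>(i, r) e. elim_sol (Suc l) (a e) (b e r) i) ` ({..<Suc l} \<times> R)
      \<subseteq> A' \<union> B' \<union> (X' \<union>
      (\<lambda>r e. (b e r l - (\<Sum>j<l. a e l j * elim_sol l (schur l (a e)) (b' e r) j)) / a e l l) ` R)"
    proof
      fix f assume "f \<in> (\<lambda>(i, r) e. elim_sol (Suc l) (a e) (b e r) i) ` ({..<Suc l} \<times> R)"
      then obtain i r where f: "f = (\<lambda>e. elim_sol (Suc l) (a e) (b e r) i)" "i < Suc l" "r \<in> R"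
        by auto
      have b'_eq: "b' e r = (\<lambda>i. b e r i - a e i l * b e r l / a e l l)" for e
        by (simp add: b'_def fun_eq_iff)
      have "(\<lambda>e. elim_sol (Suc l) (a e) (b e r) i) = (\<lambda>e. if i = l
          then (b e r l - (\<Sum>j<l. a e l j * elim_sol l (schur l (a e)) (b' e r) j)) / a e l l
          else elim_sol l (schur l (a e)) (b' e r) i)"
        by (rule ext) (simp add: Let_def b'_eq)
      with f show "f \<in> A' \<union> B' \<union> (X' \<union>
        (\<lambda>r e. (b e r l - (\<Sum>j<l. a e l j * elim_sol l (schur l (a e)) (b' e r) j)) / a e l l) ` R)"
        by (cases "i = l") (auto simp: X'_def less_Suc_eq)
    qed
  qed auto
qed

section \<open>Weighted least squares by normal equations\<close>

definition normal_mat :: "'r set \<Rightarrow> ('r \<Rightarrow> real) \<Rightarrow> ('r \<Rightarrow> nat \<Rightarrow> real) \<Rightarrow> nat \<Rightarrow> nat \<Rightarrow> real" where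
  "normal_mat I v m j l = (\<Sum>r\<in>I. v r * m r j * m r l)"

definition normal_rhs :: "'r set \<Rightarrow> ('r \<Rightarrow> real) \<Rightarrow> ('r \<Rightarrow> nat \<Rightarrow> real) \<Rightarrow> ('r \<Rightarrow> real) \<Rightarrow> nat \<Rightarrow> real" where
  "normal_rhs I v m q j = (\<Sum>r\<in>I. v r * m r j * q r)"

definition lsq :: "nat \<Rightarrow> 'r set \<Rightarrow> ('r \<Rightarrow> real) \<Rightarrow> ('r \<Rightarrow> nat \<Rightarrow> real) \<Rightarrow> ('r \<Rightarrow> real) \<Rightarrow> (nat \<Rightarrow> real) \<Rightarrow> real" where
  "lsq s I v m q x = (\<Sum>r\<in>I. v r * ((\<Sum>l<s. m r l * x l) - q r)\<^sup>2)"

definition lsq_sol :: "nat \<Rightarrow> 'r set \<Rightarrow> ('r \<Rightarrow> real) \<Rightarrow> ('r \<Rightarrow> nat \<Rightarrow> real) \<Rightarrow> ('r \<Rightarrow> real) \<Rightarrow> nat \<Rightarrow> real" where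
  "lsq_sol s I v m q = elim_sol s (normal_mat I v m) (normal_rhs I v m q)"

definition lsq_resid :: "nat \<Rightarrow> 'r set \<Rightarrow> ('r \<Rightarrow> real) \<Rightarrow> ('r \<Rightarrow> nat \<Rightarrow> real) \<Rightarrow> ('r \<Rightarrow> real) \<Rightarrow> 'r \<Rightarrow> real" where
  "lsq_resid s I v m q r = q r - (\<Sum>l<s. m r l * lsq_sol s I v m q l)"

lemma normal_mat_apply:
  "(\<Sum>l<s. normal_mat I v m j l * x l) = (\<Sum>r\<in>I. v r * m r j * (\<Sum>l<s. m r l * x l))"
  unfolding normal_mat_def sum_distrib_right sum_distrib_left
  by (subst sum.swap) (simp add: mult.assoc)

lemma normal_mat_quadratic_form:
  "(\<Sum>j<s. x j * (\<Sum>l<s. normal_mat I v m j l * x l)) = (\<Sum>r\<in>I. v r * (\<Sum>l<s. m r l * x l)\<^sup>2)"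
proof -
  have "(\<Sum>j<s. x j * (\<Sum>l<s. normal_mat I v m j l * x l))
      = (\<Sum>j<s. \<Sum>r\<in>I. v r * ((m r j * x j) * (\<Sum>l<s. m r l * x l)))"
    unfolding normal_mat_apply by (simp add: sum_distrib_left mult_ac)
  also have "\<dots> = (\<Sum>r\<in>I. v r * ((\<Sum>j<s. m r j * x j) * (\<Sum>l<s. m r l * x l)))"
    by (subst sum.swap) (simp only: sum_distrib_left[symmetric] sum_distrib_right[symmetric])
  finally show ?thesis
    by (simp add: power2_eq_square)
qed

lemma pivots_nonzero_normal_mat:
  assumes "finite I" "\<And>r. r \<in> I \<Longrightarrow> v r \<ge> 0"
    and inj: "\<And>x. (\<And>r. r \<in> I \<Longrightarrow> v r * (\<Sum>l<s. m r l * x l)\<^sup>2 = 0) \<Longrightarrow> \<forall>l<s. x l = 0"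
  shows "pivots_nonzero s (normal_mat I v m)"
proof (rule positive_definite_imp_pivots_nonzero)
  fix x :: "nat \<Rightarrow> real" assume x: "\<exists>i<s. x i \<noteq> 0"
  have "(\<Sum>r\<in>I. v r * (\<Sum>l<s. m r l * x l)\<^sup>2) \<noteq> 0"
  proof
    assume "(\<Sum>r\<in>I. v r * (\<Sum>l<s. m r l * x l)\<^sup>2) = 0"
    then have "\<forall>r\<in>I. v r * (\<Sum>l<s. m r l * x l)\<^sup>2 = 0"
      using assms(1,2) by (subst (asm) sum_nonneg_eq_0_iff) simp_all
    then show False
      using inj[of x] x by blast
  qed
  moreover have "(\<Sum>r\<in>I. v r * (\<Sum>l<s. m r l * x l)\<^sup>2) \<ge> 0"
    using assms(2) by (intro sum_nonneg) auto
  ultimately show "(\<Sum>i<s. x i * (\<Sum>j<s. normal_mat I v m i j * x j)) > 0"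
    unfolding normal_mat_quadratic_form by linarith
qed

lemma normal_equations:
  assumes "pivots_nonzero s (normal_mat I v m)" "j < s"
  shows "(\<Sum>r\<in>I. v r * m r j * lsq_resid s I v m q r) = 0"
proof -
  have "(\<Sum>l<s. normal_mat I v m j l * lsq_sol s I v m q l) = normal_rhs I v m q j"
    unfolding lsq_sol_def by (rule elim_sol_solves[OF assms])
  then show ?thesis
    by (simp add: normal_mat_apply normal_rhs_def lsq_resid_def right_diff_distrib sum_subtractf)
qed

lemma lsq_lsq_sol: "lsq s I v m q (lsq_sol s I v m q) = (\<Sum>r\<in>I. v r * (lsq_resid s I v m q r)\<^sup>2)"
  by (simp add: lsq_def lsq_resid_def power2_commute)

text \<open>
  By the normal equations the weighted residual is orthogonal to the column space, so the cross
  term vanishes when the square is expanded around the solution.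
\<close>

lemma lsq_pythagoras:
  fixes q :: "'r \<Rightarrow> real"
  assumes "pivots_nonzero s (normal_mat (I :: 'r set) v m)"
  defines "x \<equiv> lsq_sol s I v m q"
  shows "lsq s I v m q y = lsq s I v m q x + (\<Sum>r\<in>I. v r * (\<Sum>l<s. m r l * (y l - x l))\<^sup>2)"
proof -
  define \<rho> where "\<rho> = lsq_resid s I v m q"
  define \<delta> where "\<delta> r = (\<Sum>l<s. m r l * (y l - x l))" for r
  have "(\<Sum>r\<in>I. v r * \<rho> r * \<delta> r) = (\<Sum>l<s. (y l - x l) * (\<Sum>r\<in>I. v r * m r l * \<rho> r))"
    unfolding sum_distrib_left \<delta>_def by (subst sum.swap) (simp add: mult_ac)
  also have "\<dots> = 0"
    using normal_equations[OF assms(1)] by (simp add: \<rho>_def)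
  finally have orth: "(\<Sum>r\<in>I. v r * \<rho> r * \<delta> r) = 0" .
  have "(\<Sum>l<s. m r l * y l) - q r = \<delta> r - \<rho> r" for r
    by (simp add: lsq_resid_def x_def \<rho>_def \<delta>_def right_diff_distrib sum_subtractf)
  then have "lsq s I v m q y = (\<Sum>r\<in>I. v r * (\<delta> r - \<rho> r)\<^sup>2)"
    by (simp only: lsq_def)
  also have "\<dots> = (\<Sum>r\<in>I. v r * (\<rho> r)\<^sup>2 + v r * (\<delta> r)\<^sup>2 - 2 * (v r * \<rho> r * \<delta> r))"
    by (simp add: power2_diff algebra_simps)
  also have "\<dots> = lsq s I v m q x + (\<Sum>r\<in>I. v r * (\<delta> r)\<^sup>2) - 2 * (\<Sum>r\<in>I. v r * \<rho> r * \<delta> r)"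
    by (simp only: sum_subtractf sum.distrib sum_distrib_left x_def \<rho>_def lsq_lsq_sol)
  finally show ?thesis
    unfolding orth by (simp add: \<delta>_def)
qed

lemma lsq_sol_minimal:
  assumes "pivots_nonzero s (normal_mat I v m)" "\<And>r. r \<in> I \<Longrightarrow> v r \<ge> 0"
  shows "lsq s I v m q (lsq_sol s I v m q) \<le> lsq s I v m q y"
  unfolding lsq_pythagoras[OF assms(1), of q y] using assms(2) by (simp add: sum_nonneg)

text \<open>
  By the identity above, the difference of two minimizers is annihilated by the matrix up to the
  weights, hence by the normal matrix, which elimination shows to be injective.
\<close>

lemma lsq_sol_unique:
  assumes "finite I" "pivots_nonzero s (normal_mat I v m)" "\<And>r. r \<in> I \<Longrightarrow> v r \<ge> 0"
    and "lsq s I v m q y \<le> lsq s I v m q (lsq_sol s I v m q)" "i < s"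
  shows "y i = lsq_sol s I v m q i"
proof -
  define z where "z l = y l - lsq_sol s I v m q l" for l
  have "(\<Sum>r\<in>I. v r * (\<Sum>l<s. m r l * z l)\<^sup>2) \<le> 0"
    using lsq_pythagoras[OF assms(2), of q y] assms(4) by (simp add: z_def)
  then have "(\<Sum>r\<in>I. v r * (\<Sum>l<s. m r l * z l)\<^sup>2) = 0"
    using assms(3) by (intro antisym sum_nonneg) auto
  then have zero: "v r * (\<Sum>l<s. m r l * z l) = 0" if "r \<in> I" for r
    using assms(1,3) that by (subst (asm) sum_nonneg_eq_0_iff) simp_all
  have "(\<Sum>l<s. normal_mat I v m j l * z l) = 0" for j
    unfolding normal_mat_apply using zero by (intro sum.neutral) (auto simp: mult_ac)
  then have "z i = elim_sol s (normal_mat I v m) (\<lambda>_. 0) i"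
    using assms(2,5) by (intro elim_sol_unique) auto
  moreover have "0 = elim_sol s (normal_mat I v m) (\<lambda>_. 0) i"
    using elim_sol_unique[OF assms(2), of "\<lambda>_. 0" "\<lambda>_. 0"] assms(5) by simp
  ultimately show ?thesis
    by (simp add: z_def)
qed

text \<open>
  The following two are the derivatives of the solution and of the residual when the matrix m moves
  in the direction m'. The solution derivative solves a system with the same normal matrix; its
  right-hand side is what remains of the differentiated normal equations.
\<close>

definition lsq_sol_deriv ::
  "nat \<Rightarrow> 'r set \<Rightarrow> ('r \<Rightarrow> real) \<Rightarrow> ('r \<Rightarrow> nat \<Rightarrow> real) \<Rightarrow> ('r \<Rightarrow> real) \<Rightarrow> ('r \<Rightarrow> nat \<Rightarrow> real) \<Rightarrow> nat \<Rightarrow> real" where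
  "lsq_sol_deriv s I v m q m' = elim_sol s (normal_mat I v m)
     (\<lambda>j. \<Sum>r\<in>I. v r * (m' r j * lsq_resid s I v m q r - m r j * (\<Sum>l<s. m' r l * lsq_sol s I v m q l)))"

definition lsq_resid_deriv ::
  "nat \<Rightarrow> 'r set \<Rightarrow> ('r \<Rightarrow> real) \<Rightarrow> ('r \<Rightarrow> nat \<Rightarrow> real) \<Rightarrow> ('r \<Rightarrow> real) \<Rightarrow> ('r \<Rightarrow> nat \<Rightarrow> real) \<Rightarrow> 'r \<Rightarrow> real" where
  "lsq_resid_deriv s I v m q m' r =
     0 - (\<Sum>l<s. m' r l * lsq_sol s I v m q l + m r l * lsq_sol_deriv s I v m q m' l)"

lemma eventually_normal_pivots_nonzero:
  assumes "\<And>r l. r \<in> I \<Longrightarrow> l < s \<Longrightarrow> ((\<lambda>t. m t r l) has_real_derivative m' r l) (at t0)"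
    and "pivots_nonzero s (normal_mat I v (m t0))" "finite I"
  shows "\<forall>\<^sub>F t in nhds t0. pivots_nonzero s (normal_mat I v (m t))"
proof (rule eventually_pivots_nonzero)
  have "(\<lambda>t. m t r l) differentiable (at t0)" if "r \<in> I" "l < s" for r l
    using assms(1)[OF that] real_differentiable_def by blast
  then show "(\<lambda>t. normal_mat I v (m t) i j) differentiable (at t0)" if "i < s" "j < s" for i j
    unfolding normal_mat_def using that assms(3)
    by (intro differentiable_sum differentiable_mult ballI differentiable_const) auto
qed (rule assms(2))

text \<open>
  Differentiability is read off from the elimination formula. The value of the derivative then
  follows by differentiating the normal equations, which hold near t0, instead of that formula.
\<close>

lemma lsq_sol_has_derivative:
  assumes deriv: "\<And>r l. r \<in> I \<Longrightarrow> l < s \<Longrightarrow> ((\<lambda>t. m t r l) has_real_derivative m' r l) (at t0)"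
    and piv: "pivots_nonzero s (normal_mat I v (m t0))" and "finite I" "i < s"
  shows "((\<lambda>t. lsq_sol s I v (m t) q i) has_real_derivative lsq_sol_deriv s I v (m t0) q m' i) (at t0)"
proof -
  let ?x = "\<lambda>t. lsq_sol s I v (m t) q" and ?\<rho> = "\<lambda>t. lsq_resid s I v (m t) q"
  have m: "(\<lambda>t. m t r l) differentiable (at t0)" if "r \<in> I" "l < s" for r l
    using deriv[OF that] real_differentiable_def by blast
  have "(\<lambda>t. ?x t l) differentiable (at t0)" if "l < s" for l
    unfolding lsq_sol_def
  proof (rule elim_sol_differentiable[where a = "\<lambda>t. normal_mat I v (m t)", OF _ _ piv that])
    show "(\<lambda>t. normal_mat I v (m t) i j) differentiable (at t0)" if "i < s" "j < s" for i j
      unfolding normal_mat_def using that m assms(3)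
      by (intro differentiable_sum differentiable_mult ballI differentiable_const) auto
    show "(\<lambda>t. normal_rhs I v (m t) q j) differentiable (at t0)" if "j < s" for j
      unfolding normal_rhs_def using that m assms(3)
      by (intro differentiable_sum differentiable_mult ballI differentiable_const) auto
  qed
  then have "\<forall>l. \<exists>D. l < s \<longrightarrow> ((\<lambda>t. ?x t l) has_real_derivative D) (at t0)"
    by (auto simp: real_differentiable_def)
  from choice[OF this] obtain x' where x': "((\<lambda>t. ?x t l) has_real_derivative x' l) (at t0)" if "l < s" for l
    by blast
  have \<rho>': "((\<lambda>t. ?\<rho> t r) has_real_derivative
      0 - (\<Sum>l<s. m' r l * ?x t0 l + x' l * m t0 r l)) (at t0)" if "r \<in> I" for r
    unfolding lsq_resid_def using that
    by (intro DERIV_diff DERIV_const DERIV_sum DERIV_mult deriv x') auto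
  have "x' i = elim_sol s (normal_mat I v (m t0))
      (\<lambda>j. \<Sum>r\<in>I. v r * (m' r j * ?\<rho> t0 r - m t0 r j * (\<Sum>l<s. m' r l * ?x t0 l))) i"
  proof (rule elim_sol_unique[OF piv _ \<open>i < s\<close>])
    fix j assume j: "j < s"
    have 1: "((\<lambda>t. \<Sum>r\<in>I. v r * (m t r j * ?\<rho> t r)) has_real_derivative
        (\<Sum>r\<in>I. v r * (m' r j * ?\<rho> t0 r + (0 - (\<Sum>l<s. m' r l * ?x t0 l + x' l * m t0 r l)) * m t0 r j))) (at t0)"
      using j by (intro DERIV_sum DERIV_cmult DERIV_mult deriv \<rho>') auto
    have "\<forall>\<^sub>F t in nhds t0. pivots_nonzero s (normal_mat I v (m t))"
      by (rule eventually_normal_pivots_nonzero[OF deriv piv \<open>finite I\<close>])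
    then have 2: "\<forall>\<^sub>F t in nhds t0. (\<Sum>r\<in>I. v r * (m t r j * ?\<rho> t r)) = 0"
    proof eventually_elim
      case (elim t)
      from normal_equations[OF this j] show ?case
        by (simp add: mult.assoc)
    qed
    have "((\<lambda>t. 0) has_real_derivative
        (\<Sum>r\<in>I. v r * (m' r j * ?\<rho> t0 r + (0 - (\<Sum>l<s. m' r l * ?x t0 l + x' l * m t0 r l)) * m t0 r j))) (at t0)"
      by (rule DERIV_cong_ev[OF refl 2 refl, THEN iffD1, OF 1])
    then have "(\<Sum>r\<in>I. v r * (m' r j * ?\<rho> t0 r + (0 - (\<Sum>l<s. m' r l * ?x t0 l + x' l * m t0 r l)) * m t0 r j)) = 0"
      by (rule DERIV_unique) simp
    moreover have "v r * (m' r j * ?\<rho> t0 r + (0 - (\<Sum>l<s. m' r l * ?x t0 l + x' l * m t0 r l)) * m t0 r j)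
        = v r * (m' r j * ?\<rho> t0 r - m t0 r j * (\<Sum>l<s. m' r l * ?x t0 l))
          - v r * m t0 r j * (\<Sum>l<s. m t0 r l * x' l)" for r
      by (simp add: sum.distrib algebra_simps)
    ultimately show "(\<Sum>l<s. normal_mat I v (m t0) j l * x' l)
        = (\<Sum>r\<in>I. v r * (m' r j * ?\<rho> t0 r - m t0 r j * (\<Sum>l<s. m' r l * ?x t0 l)))"
      unfolding normal_mat_apply by (simp add: sum_subtractf)
  qed
  then show ?thesis
    using x'[OF \<open>i < s\<close>] by (simp add: lsq_sol_deriv_def)
qed

lemma lsq_resid_has_derivative:
  assumes deriv: "\<And>r l. r \<in> I \<Longrightarrow> l < s \<Longrightarrow> ((\<lambda>t. m t r l) has_real_derivative m' r l) (at t0)"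
    and piv: "pivots_nonzero s (normal_mat I v (m t0))" and "finite I" "r \<in> I"
  shows "((\<lambda>t. lsq_resid s I v (m t) q r) has_real_derivative lsq_resid_deriv s I v (m t0) q m' r) (at t0)"
proof -
  have "((\<lambda>t. lsq_resid s I v (m t) q r) has_real_derivative
     0 - (\<Sum>l<s. m' r l * lsq_sol s I v (m t0) q l + lsq_sol_deriv s I v (m t0) q m' l * m t0 r l)) (at t0)"
    unfolding lsq_resid_def using assms(4)
    by (intro DERIV_diff DERIV_const DERIV_sum DERIV_mult deriv
        lsq_sol_has_derivative[OF deriv piv \<open>finite I\<close>]) auto
  then show ?thesis
    by (simp add: lsq_resid_deriv_def mult.commute)
qed

section \<open>Flops for sparse least squares problems\<close>

text \<open>
  A family of least squares problems, indexed by inputs e in E, together with directions \<pi> in Q in which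
  the matrix is differentiated. S is the sparsity pattern. Constants that are integers are free, which is
  why the directions have integer entries. One number \<beta> bounds the row and column counts, the bandwidth
  and the number of directions; for variable projection all of these are at most the number of parameters.
\<close>

locale sparse_lsq =
  fixes E :: "('v \<Rightarrow> real) set" and I :: "'r set" and s \<beta> :: nat and S :: "('r \<times> nat) set"
    and v q :: "('v \<Rightarrow> real) \<Rightarrow> 'r \<Rightarrow> real" and m :: "('v \<Rightarrow> real) \<Rightarrow> 'r \<Rightarrow> nat \<Rightarrow> real"
    and Q :: "'p set" and m' :: "'p \<Rightarrow> 'r \<Rightarrow> nat \<Rightarrow> real"
  assumes finite_I: "finite I" and I_nonempty: "I \<noteq> {}" and s_le: "s \<le> card I"
    and finite_Q: "finite Q" and card_Q: "card Q \<le> \<beta>" and \<beta>_pos: "1 \<le> \<beta>"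
    and card_col: "\<And>j. j < s \<Longrightarrow> card {r \<in> I. (r, j) \<in> S} \<le> \<beta>"
    and card_row: "\<And>r. r \<in> I \<Longrightarrow> card {l. l < s \<and> (r, l) \<in> S} \<le> \<beta>"
    and band: "\<And>r j l. r \<in> I \<Longrightarrow> (r, j) \<in> S \<Longrightarrow> (r, l) \<in> S \<Longrightarrow> j < l + \<beta>"
    and m_zero: "\<And>e r l. e \<in> E \<Longrightarrow> r \<in> I \<Longrightarrow> l < s \<Longrightarrow> (r, l) \<notin> S \<Longrightarrow> m e r l = 0"
    and m'_zero: "\<And>\<pi> r l. \<pi> \<in> Q \<Longrightarrow> r \<in> I \<Longrightarrow> l < s \<Longrightarrow> (r, l) \<notin> S \<Longrightarrow> m' \<pi> r l = 0"
    and m'_row: "\<And>\<pi> r. \<pi> \<in> Q \<Longrightarrow> r \<in> I \<Longrightarrow> card {l. l < s \<and> m' \<pi> r l \<noteq> 0} \<le> 1"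
    and m'_int: "\<And>\<pi> r l. m' \<pi> r l \<in> \<int>"
    and v_free: "\<And>F r. r \<in> I \<Longrightarrow> computes E F 0 {\<lambda>e. v e r}"
    and q_free: "\<And>F r. r \<in> I \<Longrightarrow> computes E F 0 {\<lambda>e. q e r}"
    and m_free: "\<And>F r l. r \<in> I \<Longrightarrow> l < s \<Longrightarrow> computes E F 0 {\<lambda>e. m e r l}"
    and v_nonneg: "\<And>e r. e \<in> E \<Longrightarrow> r \<in> I \<Longrightarrow> v e r \<ge> 0"
    and pivots: "\<And>e. e \<in> E \<Longrightarrow> pivots_nonzero s (normal_mat I (v e) (m e))"
begin

text \<open>
  Here x is the solution, \<rho> the residual, y the residual scaled by the square roots of the weights, and
  x' and y' are the derivatives of x and y in the direction \<pi>; b' is the right-hand side of the system for x'.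
\<close>

abbreviation "A e \<equiv> normal_mat I (v e) (m e)"
abbreviation "x e \<equiv> lsq_sol s I (v e) (m e) (q e)"
abbreviation "\<rho> e \<equiv> lsq_resid s I (v e) (m e) (q e)"
abbreviation "y e r \<equiv> sqrt (v e r) * \<rho> e r"
abbreviation "b' e \<pi> j \<equiv> \<Sum>r\<in>I. v e r * (m' \<pi> r j * \<rho> e r - m e r j * (\<Sum>l<s. m' \<pi> r l * x e l))"
abbreviation "x' e \<pi> \<equiv> lsq_sol_deriv s I (v e) (m e) (q e) (m' \<pi>)"
abbreviation "y' e \<pi> r \<equiv> sqrt (v e r) * lsq_resid_deriv s I (v e) (m e) (q e) (m' \<pi>) r"

lemma m'_free:
  "computes E F 0 {\<lambda>e. m' \<pi> r l}"
proof -
  obtain c :: int where "m' \<pi> r l = of_int c"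
    using m'_int Ints_cases by blast
  then show ?thesis
    using computes_Const[of E F 0 c] by simp
qed

lemma normal_mat_band:
  assumes "e \<in> E" "j < s" "l < s" "A e j l \<noteq> 0"
  shows "j < l + \<beta> \<and> l < j + \<beta>"
proof -
  obtain r where "r \<in> I" "m e r j \<noteq> 0" "m e r l \<noteq> 0"
    using assms(4) unfolding normal_mat_def by (metis (no_types, lifting) mult_zero_left mult_zero_right sum.neutral)
  then have "r \<in> I" "(r, j) \<in> S" "(r, l) \<in> S"
    using m_zero assms by blast+
  then show ?thesis
    using band by blast
qed

definition "vals_A = (\<lambda>(j, l) e. A e j l) ` ({..<s} \<times> {..<s})"

text \<open>
  Two factors \<beta> arise: one from the band of the normal matrix, one from the length of the inner products.
\<close>

lemma computes_A: "computes E F (s * (2 * \<beta>) * (3 * \<beta>)) vals_A"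
proof -
  define J where "J = Sigma {..<s} (\<lambda>j. {l. l < s \<and> j < l + \<beta> \<and> l < j + \<beta>})"
  have "card {l. l < s \<and> j < l + \<beta> \<and> l < j + \<beta>} \<le> 2 * \<beta>" for j
    using card_mono[of "{j + 1 - \<beta>..<j + \<beta>}" "{l. l < s \<and> j < l + \<beta> \<and> l < j + \<beta>}"] by fastforce
  then have "card J \<le> s * (2 * \<beta>)"
    unfolding J_def using sum_bounded_above[of "{..<s}" "\<lambda>j. card {l. l < s \<and> j < l + \<beta> \<and> l < j + \<beta>}" "2 * \<beta>"]
    by simp
  moreover have "computes E F (card J * (3 * \<beta>)) vals_A"
    unfolding vals_A_def
  proof (rule computes_image_support)
    show "computes E F (3 * \<beta>) {(\<lambda>(j, l) e. A e j l) jl}" if jl_J: "jl \<in> J" for jl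
    proof -
      obtain j l where jl: "jl = (j, l)" "j < s" "l < s"
        using jl_J unfolding J_def by blast
      have "computes E F (card {r \<in> I. (r, j) \<in> S} * ((0 + 0 + 1 + 0 + 1) + 1)) {\<lambda>e. A e j l}"
        unfolding normal_mat_def using finite_I jl m_zero
        by (intro computes_sum_support computes_mult v_free m_free) auto
      then show ?thesis
        unfolding jl by simp (rule computes_mono, use card_col[OF jl(2)] in auto)
    qed
    show "computes E F 0 {(\<lambda>(j, l) e. A e j l) jl}" if jl_J: "jl \<in> {..<s} \<times> {..<s} - J" for jl
    proof -
      obtain j l where jl: "jl = (j, l)" "j < s" "l < s" "(j, l) \<notin> J"
        using jl_J by blast
      then have "A e j l = 0" if "e \<in> E" for e
        using normal_mat_band[OF that, of j l] by (auto simp: J_def)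
      then show ?thesis
        unfolding jl by (auto intro: computes_cong[OF computes_zero])
    qed
  qed (auto simp: J_def)
  ultimately show ?thesis
    by (elim computes_mono) (auto simp: mult_ac)
qed

lemma computes_b:
  "computes E F (s * (3 * \<beta>)) ((\<lambda>j e. normal_rhs I (v e) (m e) (q e) j) ` {..<s})"
proof -
  have "computes E F (3 * \<beta>) {\<lambda>e. normal_rhs I (v e) (m e) (q e) j}" if "j < s" for j
  proof -
    have "computes E F (card {r \<in> I. (r, j) \<in> S} * ((0 + 0 + 1 + 0 + 1) + 1))
        {\<lambda>e. normal_rhs I (v e) (m e) (q e) j}"
      unfolding normal_rhs_def using finite_I that m_zero
      by (intro computes_sum_support computes_mult v_free m_free q_free) auto
    then show ?thesis
      by (rule computes_mono) (use card_col[OF that] in auto)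
  qed
  then have "computes E F (card {..<s} * (3 * \<beta>)) ((\<lambda>j e. normal_rhs I (v e) (m e) (q e) j) ` {..<s})"
    by (intro computes_image) auto
  then show ?thesis
    by simp
qed

definition "vals_x = (\<lambda>j e. x e j) ` {..<s}"
definition "vals_\<rho> = (\<lambda>r e. \<rho> e r) ` I"
definition "vals_y = (\<lambda>r e. y e r) ` I"
definition "vals_b' = (\<lambda>(\<pi>, j) e. b' e \<pi> j) ` (Q \<times> {..<s})"
definition "vals_x' = (\<lambda>(j, \<pi>) e. x' e \<pi> j) ` ({..<s} \<times> Q)"
definition "vals_y' = (\<lambda>(\<pi>, r) e. y' e \<pi> r) ` (Q \<times> I)"

lemma computes_x:
  "vals_A \<subseteq> F \<Longrightarrow> computes E F (s * (3 * \<beta>) + s * (3 * \<beta>\<^sup>2 + 5 * \<beta> + 2)) vals_x"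
proof (rule computes_mono[OF computes_trans[OF computes_b]])
  assume A: "vals_A \<subseteq> F"
  show "computes E (F \<union> (\<lambda>j e. normal_rhs I (v e) (m e) (q e) j) ` {..<s})
      (s * (3 * \<beta>\<^sup>2 + 5 * \<beta> * card {()} + 2 * card {()}))
      ((\<lambda>(i, r) e. elim_sol s (A e) (normal_rhs I (v e) (m e) (q e)) i) ` ({..<s} \<times> {()}))"
    by (rule computes_elim_sol) (use A normal_mat_band pivots in \<open>auto simp: vals_A_def\<close>)
  show "vals_x \<subseteq> (\<lambda>j e. normal_rhs I (v e) (m e) (q e) j) ` {..<s} \<union>
      (\<lambda>(i, r) e. elim_sol s (A e) (normal_rhs I (v e) (m e) (q e)) i) ` ({..<s} \<times> {()})"
    by (auto simp: vals_x_def lsq_sol_def)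
qed auto

lemma computes_\<rho>:
  assumes "vals_x \<subseteq> F"
  shows "computes E F (card I * (2 * \<beta> + 1)) vals_\<rho>"
  unfolding vals_\<rho>_def
proof (rule computes_image[OF finite_I])
  fix r assume r: "r \<in> I"
  have "computes E F (0 + card {l. l < s \<and> (r, l) \<in> S} * ((0 + 0 + 1) + 1) + 1) {\<lambda>e. \<rho> e r}"
    unfolding lsq_resid_def using r m_zero assms
    by (intro computes_diff computes_sum_support computes_mult m_free q_free computes_mem)
      (auto simp: vals_x_def)
  then show "computes E F (2 * \<beta> + 1) {\<lambda>e. \<rho> e r}"
    by (rule computes_mono) (use card_row[OF r] in auto)
qed

lemma computes_y:
  assumes "vals_\<rho> \<subseteq> F"
  shows "computes E F (card I * 2) vals_y"
  unfolding vals_y_def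
proof (rule computes_image[OF finite_I])
  fix r assume r: "r \<in> I"
  have "computes E F ((0 + 1) + 0 + 1) {\<lambda>e. y e r}"
    using r assms v_nonneg
    by (intro computes_mult computes_sqrt v_free computes_mem) (auto simp: vals_\<rho>_def)
  then show "computes E F 2 {\<lambda>e. y e r}"
    by (simp add: numeral_eq_Suc)
qed

text \<open>
  The inner sum has at most one nonzero term because a direction has at most one nonzero entry in each
  row. This is what keeps the cost of a right-hand side entry proportional to \<beta>.
\<close>

lemma computes_b':
  assumes "vals_x \<subseteq> F" "vals_\<rho> \<subseteq> F"
  shows "computes E F (card Q * s * (7 * \<beta>)) vals_b'"
proof -
  have "computes E F (7 * \<beta>) {\<lambda>e. b' e \<pi> j}" if \<pi>: "\<pi> \<in> Q" and j: "j < s" for \<pi> j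
  proof -
    have inner: "computes E F 2 {\<lambda>e. \<Sum>l<s. m' \<pi> r l * x e l}" if "r \<in> I" for r
    proof -
      have "computes E F (card {l. l < s \<and> m' \<pi> r l \<noteq> 0} * ((0 + 0 + 1) + 1))
          {\<lambda>e. \<Sum>l<s. m' \<pi> r l * x e l}"
        using assms(1)
        by (intro computes_sum_support computes_mult m'_free computes_mem) (auto simp: vals_x_def)
      then show ?thesis
        by (rule computes_mono) (use m'_row[OF \<pi> that] in auto)
    qed
    have "computes E F (card {r \<in> I. (r, j) \<in> S} * ((0 + ((0 + 0 + 1) + (0 + 2 + 1) + 1) + 1) + 1))
        {\<lambda>e. b' e \<pi> j}"
      using finite_I j \<pi> m_zero m'_zero assms(2)
      by (intro computes_sum_support computes_mult computes_diff v_free m'_free m_free inner computes_mem)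
        (auto simp: vals_\<rho>_def)
    then show ?thesis
      by (rule computes_mono) (use card_col[OF j] in auto)
  qed
  then have "computes E F (card (Q \<times> {..<s}) * (7 * \<beta>)) vals_b'"
    unfolding vals_b'_def using finite_Q by (intro computes_image) auto
  then show ?thesis
    by (simp add: card_cartesian_product)
qed

lemma computes_x':
  assumes "vals_A \<subseteq> F" "vals_b' \<subseteq> F"
  shows "computes E F (s * (3 * \<beta>\<^sup>2 + 5 * \<beta> * card Q + 2 * card Q)) vals_x'"
  unfolding vals_x'_def lsq_sol_deriv_def
  by (rule computes_elim_sol[where b = b'])
    (use finite_Q assms normal_mat_band pivots in \<open>auto simp: vals_A_def vals_b'_def\<close>)

text \<open>
  Here the Jacobian is formed, an array of at most \<beta> times \<open>card I\<close> entries with \<beta>-term inner products.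
  Together with the elimination for all directions at once it determines the order of the total cost.
\<close>

lemma computes_y':
  assumes "vals_x \<subseteq> F" "vals_x' \<subseteq> F"
  shows "computes E F (card Q * card I * (4 * \<beta> + 3)) vals_y'"
proof -
  have "computes E F (4 * \<beta> + 3) {\<lambda>e. y' e \<pi> r}" if \<pi>: "\<pi> \<in> Q" and r: "r \<in> I" for \<pi> r
  proof -
    have "computes E F ((0 + 1) +
        (0 + card {l. l < s \<and> (r, l) \<in> S} * (((0 + 0 + 1) + (0 + 0 + 1) + 1) + 1) + 1) + 1) {\<lambda>e. y' e \<pi> r}"
      unfolding lsq_resid_deriv_def using \<pi> r m_zero m'_zero assms v_nonneg
      by (intro computes_mult computes_sqrt computes_diff computes_sum_support computes_add
          v_free m'_free m_free computes_zero computes_mem) (auto simp: vals_x_def vals_x'_def)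
    then show ?thesis
      by (rule computes_mono) (use card_row[OF r] in auto)
  qed
  then have "computes E F (card (Q \<times> I) * (4 * \<beta> + 3)) vals_y'"
    unfolding vals_y'_def using finite_Q finite_I by (intro computes_image) auto
  then show ?thesis
    by (simp add: card_cartesian_product)
qed

text \<open>
  Once the Jacobian is there, the gradient of the squared norm of y costs only matrix-vector
  products.
\<close>

lemma computes_sum_of_squares:
  assumes "vals_y \<subseteq> F" "vals_y' \<subseteq> F"
  shows "computes E F (card I * 2 + card Q * (card I * 2 + 1))
    ({\<lambda>e. \<Sum>r\<in>I. y e r * y e r} \<union> (\<lambda>\<pi> e. 2 * (\<Sum>r\<in>I. y e r * y' e \<pi> r)) ` Q)"
proof (rule computes_Un)
  have y: "computes E F 0 {\<lambda>e. y e r}" if "r \<in> I" for r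
    using assms(1) that by (intro computes_mem) (auto simp: vals_y_def)
  have "computes E F (card I * ((0 + 0 + 1) + 1)) {\<lambda>e. \<Sum>r\<in>I. y e r * y e r}"
    by (intro computes_sum computes_mult y finite_I)
  then show "computes E F (card I * 2) {\<lambda>e. \<Sum>r\<in>I. y e r * y e r}"
    by (simp add: numeral_eq_Suc)
  have "computes E F (0 + card I * ((0 + 0 + 1) + 1) + 1) {\<lambda>e. of_int 2 * (\<Sum>r\<in>I. y e r * y' e \<pi> r)}"
    if "\<pi> \<in> Q" for \<pi>
    using assms(2) that
    by (intro computes_sum computes_mult y finite_I computes_Const computes_mem) (auto simp: vals_y'_def)
  then show "computes E F (card Q * (card I * 2 + 1)) ((\<lambda>\<pi> e. 2 * (\<Sum>r\<in>I. y e r * y' e \<pi> r)) ` Q)"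
    using finite_Q by (intro computes_image) (auto simp: numeral_eq_Suc)
qed

lemma computes_all:
  "computes E {} (60 * \<beta>\<^sup>2 * card I) (vals_y \<union> vals_y' \<union>
     ({\<lambda>e. \<Sum>r\<in>I. y e r * y e r} \<union> (\<lambda>\<pi> e. 2 * (\<Sum>r\<in>I. y e r * y' e \<pi> r)) ` Q))"
proof -
  let ?out = "{\<lambda>e. \<Sum>r\<in>I. y e r * y e r} \<union> (\<lambda>\<pi> e. 2 * (\<Sum>r\<in>I. y e r * y' e \<pi> r)) ` Q"
  let ?c = "s * (2 * \<beta>) * (3 * \<beta>) + (s * (3 * \<beta>) + s * (3 * \<beta>\<^sup>2 + 5 * \<beta> + 2)
      + (card I * (2 * \<beta> + 1) + (card I * 2 + (card Q * s * (7 * \<beta>)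
      + (s * (3 * \<beta>\<^sup>2 + 5 * \<beta> * card Q + 2 * card Q) + (card Q * card I * (4 * \<beta> + 3)
      + (card I * 2 + card Q * (card I * 2 + 1))))))))"
  have "computes E {} ?c (vals_A \<union> (vals_x \<union> (vals_\<rho> \<union> (vals_y \<union> (vals_b' \<union> (vals_x' \<union> (vals_y' \<union> ?out)))))))"
    by (intro computes_trans[OF computes_A] computes_trans[OF computes_x] computes_trans[OF computes_\<rho>]
        computes_trans[OF computes_y] computes_trans[OF computes_b'] computes_trans[OF computes_x']
        computes_trans[OF computes_y'] computes_sum_of_squares) blast+
  moreover have "?c \<le> 60 * \<beta>\<^sup>2 * card I"
  proof -
    \<comment> \<open>All terms are products of at most two factors bounded by \<beta> and one bounded by the number of rows.\<close>
    define T where "T = \<beta> * \<beta> * card I"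
    have le: "n1 * n2 * n3 \<le> T" if "n1 \<le> \<beta>" "n2 \<le> \<beta>" "n3 \<le> card I" for n1 n2 n3
      unfolding T_def using that by (intro mult_le_mono)
    have "1 \<le> card I"
      using finite_I I_nonempty by (simp add: Suc_le_eq card_gt_0_iff)
    then have bounds: "\<beta> * \<beta> * s \<le> T" "\<beta> * 1 * s \<le> T" "1 * 1 * s \<le> T" "\<beta> * 1 * card I \<le> T"
      "1 * 1 * card I \<le> T" "card Q * \<beta> * s \<le> T" "card Q * 1 * s \<le> T" "card Q * \<beta> * card I \<le> T"
      "card Q * 1 * card I \<le> T" "card Q * 1 * 1 \<le> T"
      using s_le card_Q \<beta>_pos by (intro le; simp)+
    have "?c = 12 * (\<beta> * \<beta> * s) + 8 * (\<beta> * 1 * s) + 2 * (1 * 1 * s) + 2 * (\<beta> * 1 * card I)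
        + 5 * (1 * 1 * card I) + 12 * (card Q * \<beta> * s) + 2 * (card Q * 1 * s)
        + 4 * (card Q * \<beta> * card I) + 5 * (card Q * 1 * card I) + card Q * 1 * 1"
      by (simp add: power2_eq_square algebra_simps)
    also have "\<dots> \<le> 60 * T"
      using bounds by linarith
    finally show ?thesis
      by (simp add: T_def power2_eq_square mult.assoc)
  qed
  ultimately show ?thesis
    by (elim computes_mono) auto
qed

end

section \<open>Variable projection as a least squares problem\<close>

text \<open>
  The rows of the stacked matrix are kept as pairs of the block k and the position i within the block,
  and the unknown coefficients of the tuple as pairs of the block and the degree.
\<close>

definition positions :: "nat list \<Rightarrow> (nat \<times> nat) set" where
  "positions ns = Sigma {..<length ns} (\<lambda>k. {..ns ! k})"

definition params :: "nat list \<Rightarrow> nat \<Rightarrow> (nat \<times> nat) set" where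
  "params ns d = Sigma {..<length ns} (\<lambda>k. {..ns ! k - d})"

text \<open>
  The entry of the stacked unweighted matrix in row (k, i) and column l. The coefficients are a function
  rather than a list of polynomials so that they can also be read from the program inputs.
\<close>

fun conv_entry :: "nat list \<Rightarrow> nat \<Rightarrow> (nat \<Rightarrow> nat \<Rightarrow> real) \<Rightarrow> nat \<times> nat \<Rightarrow> nat \<Rightarrow> real" where
  "conv_entry ns d c (k, i) l = (if l \<le> i \<and> i - l \<le> ns ! k - d then c k (i - l) else 0)"

text \<open>
  The derivative of the stacked matrix with respect to the coefficient of degree c in block k'.
\<close>

fun conv_unit :: "nat \<times> nat \<Rightarrow> nat \<times> nat \<Rightarrow> nat \<Rightarrow> real" where
  "conv_unit (k', c) (k, i) l = (if k = k' \<and> l \<le> i \<and> i - l = c then 1 else 0)"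

abbreviation conv_of :: "nat list \<Rightarrow> nat \<Rightarrow> real poly list \<Rightarrow> nat \<times> nat \<Rightarrow> nat \<Rightarrow> real" where
  "conv_of ns d g \<equiv> conv_entry ns d (\<lambda>k. coeff (g ! k))"

abbreviation weight_of :: "real vec list \<Rightarrow> nat \<times> nat \<Rightarrow> real" where
  "weight_of w \<equiv> \<lambda>(k, i). w ! k $ i"

abbreviation coeff_of :: "real poly list \<Rightarrow> nat \<times> nat \<Rightarrow> real" where
  "coeff_of p \<equiv> \<lambda>(k, i). coeff (p ! k) i"

abbreviation vp_pivots :: "nat list \<Rightarrow> nat \<Rightarrow> real vec list \<Rightarrow> real poly list \<Rightarrow> bool" where
  "vp_pivots ns d w g \<equiv>
     pivots_nonzero (Suc d) (normal_mat (positions ns) (weight_of w) (conv_of ns d g))"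

abbreviation vp_resid ::
  "nat list \<Rightarrow> nat \<Rightarrow> real poly list \<Rightarrow> real vec list \<Rightarrow> real poly list \<Rightarrow> nat \<times> nat \<Rightarrow> real" where
  "vp_resid ns d p w g \<equiv>
     lsq_resid (Suc d) (positions ns) (weight_of w) (conv_of ns d g) (coeff_of p)"

text \<open>
  Block and offset of an entry of a concatenation. It depends on the lengths of the blocks alone,
  so that a program can locate the outputs before the inputs are known.
\<close>

fun stack_pos :: "nat list \<Rightarrow> nat \<Rightarrow> nat \<times> nat" where
  "stack_pos [] i = (0, 0)"
| "stack_pos (n # ns) i =
     (if i < n then (0, i) else (case stack_pos ns (i - n) of (k, j) \<Rightarrow> (Suc k, j)))"

lemma concat_nth_stack_pos:
  assumes "i < length (concat xss)"
  shows "case stack_pos (map length xss) i of (k, j) \<Rightarrow>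
    k < length xss \<and> j < length (xss ! k) \<and> concat xss ! i = xss ! k ! j"
  using assms
proof (induction xss arbitrary: i)
  case (Cons xs xss)
  show ?case
  proof (cases "i < length xs")
    case False
    then show ?thesis
      using Cons.IH[of "i - length xs"] Cons.prems
      by (auto simp: nth_append split: prod.splits)
  qed (simp add: nth_append)
qed simp

lemma finite_positions: "finite (positions ns)"
  by (auto simp: positions_def)

lemma card_positions: "card (positions ns) = sum_list ns + length ns"
proof -
  have "card (positions ns) = (\<Sum>k<length ns. ns ! k + 1)"
    by (simp add: positions_def)
  then show ?thesis
    by (simp only: sum.distrib sum_list_sum_nth atLeast0LessThan) simp
qed

lemma sum_positions:
  "(\<Sum>r\<in>positions ns. f r) = (\<Sum>k<length ns. \<Sum>i\<le>ns ! k. f (k, i))"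
  unfolding positions_def by (subst sum.Sigma) auto

lemma weight_nonneg:
  "admissible_data ns p w \<Longrightarrow> r \<in> positions ns \<Longrightarrow> weight_of w r \<ge> 0"
  by (auto simp: admissible_data_def positions_def)

lemma mat_diag_mult_vec_index:
  assumes "i < n" "dim_vec y = n"
  shows "(mat_diag n f *\<^sub>v y) $ i = f i * y $ i"
proof -
  have "(mat_diag n f *\<^sub>v y) $ i = (\<Sum>j=0..<n. (if i = j then f j else 0) * y $ j)"
    using assms by (simp add: mat_diag_def scalar_prod_def)
  also have "\<dots> = (\<Sum>j=0..<n. if i = j then f j * y $ j else 0)"
    by (rule sum.cong) auto
  finally show ?thesis
    using assms by simp
qed

lemma map_length_blocks:
  assumes "\<And>k. k < length ns \<Longrightarrow> length (xs k) = ns ! k + 1"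
  shows "map length (map xs [0..<length ns]) = map Suc ns"
  using assms by (intro nth_equalityI) auto

lemma concat_blocks:
  assumes "\<And>k. k < length ns \<Longrightarrow> length (xs k) = ns ! k + 1"
  defines "L \<equiv> concat (map xs [0..<length ns])"
  shows "length L = sum_list (map Suc ns)"
    and "i < sum_list (map Suc ns) \<Longrightarrow> stack_pos (map Suc ns) i = (k, j) \<Longrightarrow>
      k < length ns \<and> j \<le> ns ! k \<and> L ! i = xs k ! j"
proof -
  have blocks: "map length (map xs [0..<length ns]) = map Suc ns"
    by (rule map_length_blocks) (rule assms(1))
  show len: "length L = sum_list (map Suc ns)"
    unfolding L_def length_concat blocks ..
  show "k < length ns \<and> j \<le> ns ! k \<and> L ! i = xs k ! j"
    if "i < sum_list (map Suc ns)" "stack_pos (map Suc ns) i = (k, j)"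
    using concat_nth_stack_pos[of i "map xs [0..<length ns]"] that len assms(1)[of k]
    unfolding L_def blocks by auto
qed

lemma stack_pos_in_positions:
  assumes "i < sum_list (map Suc ns)"
  shows "stack_pos (map Suc ns) i \<in> positions ns"
proof -
  obtain k j where kj: "stack_pos (map Suc ns) i = (k, j)"
    by fastforce
  then show ?thesis
    using concat_blocks(2)[where xs = "\<lambda>k. replicate (ns ! k + 1) ()", OF _ assms kj]
    by (simp add: positions_def)
qed

text \<open>
  If a column occurred twice, fewer than nc columns could be linearly independent; so the columns are
  distinct, and then a nontrivial kernel vector would be a linear dependence among them.
\<close>

lemma full_column_rank_mult_vec_eq_0:
  fixes A :: "real mat"
  assumes "A \<in> carrier_mat nr nc" "vec_space.rank nr A = nc" "x \<in> carrier_vec nc" "A *\<^sub>v x = 0\<^sub>v nr"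
  shows "x = 0\<^sub>v nc"
proof -
  interpret vec_space "TYPE(real)" nr .
  obtain T where T: "maximal T (\<lambda>T. T \<subseteq> set (cols A) \<and> lin_indpt T)"
    using maximal_exists[of "\<lambda>T. T \<subseteq> set (cols A) \<and> lin_indpt T" "card (set (cols A))" "{}"]
    by (meson List.finite_set card_mono empty_iff empty_subsetI finite_lin_indpt2 rev_finite_subset)
  then have "T \<subseteq> set (cols A)"
    by (simp add: maximal_def)
  then have "card T \<le> card (set (cols A))"
    by (simp add: card_mono)
  then have "length (cols A) \<le> card (set (cols A))"
    using rank_card_indpt[OF assms(1) T] assms(1,2) by simp
  then have dist: "distinct (cols A)"
    using card_distinct card_length le_antisym by metis
  show ?thesis
    using full_rank_lin_indpt[OF assms(1,2) dist] lin_depI[OF assms(1,3) _ assms(4) dist] by blast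
qed

context
  fixes ns :: "nat list" and d :: nat
  assumes d_le: "\<And>k. k < length ns \<Longrightarrow> d \<le> ns ! k"
begin

lemma mult_mat_carrier:
  "k < length ns \<Longrightarrow> mult_mat d (ns ! k - d) h \<in> carrier_mat (ns ! k + 1) (d + 1)"
  using d_le[of k] by (simp add: mult_mat_def)

lemma mult_mat_mult_vec:
  assumes "k < length ns" "i \<le> ns ! k"
  shows "(mult_mat d (ns ! k - d) (g ! k) *\<^sub>v vec (d + 1) x) $ i = (\<Sum>l<Suc d. conv_of ns d g (k, i) l * x l)"
proof -
  have "i < d + (ns ! k - d) + 1"
    using assms d_le[of k] by simp
  then show ?thesis
    by (simp add: mult_mat_def scalar_prod_def lessThan_atLeast0)
qed

lemma objective_eq_lsq:
  "objective ns d p w g h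
     = lsq (Suc d) (positions ns) (weight_of w) (conv_of ns d g) (coeff_of p) (coeff h)"
  unfolding lsq_def sum_positions objective_def wnorm2_def
proof (rule sum.cong)
  fix k assume "k \<in> {..<length ns}"
  then have k: "k < length ns"
    by simp
  have "{..<dim_vec (mult_mat d (ns ! k - d) (g ! k) *\<^sub>v coeff_vec d h - coeff_vec (ns ! k) (p ! k))} = {..ns ! k}"
    by (auto simp: coeff_vec_def)
  then show "(\<Sum>j<dim_vec (mult_mat d (ns ! k - d) (g ! k) *\<^sub>v coeff_vec d h - coeff_vec (ns ! k) (p ! k)).
       w ! k $ j * ((mult_mat d (ns ! k - d) (g ! k) *\<^sub>v coeff_vec d h - coeff_vec (ns ! k) (p ! k)) $ j)\<^sup>2)
    = (\<Sum>i\<le>ns ! k. (case (k, i) of (k, i) \<Rightarrow> w ! k $ i) *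
       ((\<Sum>l<Suc d. conv_of ns d g (k, i) l * coeff h l) - (case (k, i) of (k, i) \<Rightarrow> coeff (p ! k) i))\<^sup>2)"
    using mult_mat_mult_vec[OF k, of _ g "coeff h"]
    by (intro sum.cong) (simp_all add: coeff_vec_def del: sum.lessThan_Suc)
qed simp

text \<open>
  A minimizer exists and is unique, so the choice made by arg_min is the solution of the normal equations.
\<close>

lemma h_star_and_f2:
  assumes "admissible_data ns p w" "vp_pivots ns d w g"
  defines "x \<equiv> lsq_sol (Suc d) (positions ns) (weight_of w) (conv_of ns d g) (coeff_of p)"
  shows "l < Suc d \<Longrightarrow> coeff (h_star ns d p w g) l = x l"
    and "f2 ns d p w g = (\<Sum>r\<in>positions ns. weight_of w r * (vp_resid ns d p w g r)\<^sup>2)"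
proof -
  let ?J = "lsq (Suc d) (positions ns) (weight_of w) (conv_of ns d g) (coeff_of p)"
  define h where "h = Poly (map x [0..<Suc d])"
  have coeff_h: "coeff h l = (if l < Suc d then x l else 0)" for l
    by (auto simp: h_def nth_default_def simp del: upt_Suc)
  then have deg: "degree h \<le> d"
    by (intro degree_le) auto
  have J_h: "?J (coeff h) = ?J x"
    by (simp add: lsq_def coeff_h del: sum.lessThan_Suc)
  have min: "?J (coeff h) \<le> ?J y" for y
    unfolding J_h x_def using lsq_sol_minimal[OF assms(2) weight_nonneg[OF assms(1)]] .
  have "is_arg_min (objective ns d p w g) (\<lambda>h. degree h \<le> d) h"
    using deg min by (auto simp: is_arg_min_def objective_eq_lsq not_less)
  then have "is_arg_min (objective ns d p w g) (\<lambda>h. degree h \<le> d) (h_star ns d p w g)"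
    unfolding h_star_def arg_min_def by (rule someI)
  then have "?J (coeff (h_star ns d p w g)) \<le> ?J (coeff h)"
    using deg by (auto simp: is_arg_min_def objective_eq_lsq not_less)
  then show "coeff (h_star ns d p w g) l = x l" if "l < Suc d"
    unfolding J_h x_def
    using lsq_sol_unique[OF finite_positions assms(2) weight_nonneg[OF assms(1)] _ that] by blast
  have "f2 ns d p w g = ?J (coeff h)"
    unfolding f2_def using deg min
    by (intro Least_equality) (auto simp: objective_eq_lsq)
  then show "f2 ns d p w g = (\<Sum>r\<in>positions ns. weight_of w r * (vp_resid ns d p w g r)\<^sup>2)"
    unfolding J_h x_def lsq_lsq_sol .
qed

lemma dim_g_star:
  assumes "admissible_data ns p w"
  shows "dim_vec (g_star ns d p w g) = sum_list (map Suc ns)"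
  using assms unfolding g_star_def stack_vecs_def map_map
  by (simp add: comp_def, intro concat_blocks(1))
    (auto simp: sqrt_diag_def mat_diag_def admissible_data_def)

lemma g_star_index:
  assumes "admissible_data ns p w" "vp_pivots ns d w g" "i < sum_list (map Suc ns)"
  defines "r \<equiv> stack_pos (map Suc ns) i"
  shows "g_star ns d p w g $ i = sqrt (weight_of w r) * vp_resid ns d p w g r"
proof -
  obtain k j where kj: "r = (k, j)"
    by fastforce
  define y where "y k = sqrt_diag (w ! k) *\<^sub>v
      (coeff_vec (ns ! k) (p ! k)
        - mult_mat d (ns ! k - d) (g ! k) *\<^sub>v coeff_vec d (h_star ns d p w g))" for k
  have w: "dim_vec (w ! k) = ns ! k + 1" if "k < length ns" for k
    using assms(1) that by (auto simp: admissible_data_def)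
  have len: "length (list_of_vec (y k)) = ns ! k + 1" if "k < length ns" for k
    using w[OF that] by (simp add: y_def sqrt_diag_def mat_diag_def)
  have k: "k < length ns" and j: "j \<le> ns ! k"
    and i: "concat (map (\<lambda>k. list_of_vec (y k)) [0..<length ns]) ! i = list_of_vec (y k) ! j"
    using concat_blocks(2)[where xs = "\<lambda>k. list_of_vec (y k)", OF len assms(3)] kj by (simp_all add: r_def)
  have "g_star ns d p w g $ i = y k $ j"
    using i j len[OF k] by (simp add: g_star_def stack_vecs_def y_def[symmetric] comp_def
        list_of_vec_index vec_of_list_index)
  also have "\<dots> = sqrt (w ! k $ j) * (coeff (p ! k) j - (\<Sum>l<Suc d. conv_of ns d g (k, j) l * coeff (h_star ns d p w g) l))"
    using j w[OF k] mult_mat_mult_vec[OF k j, of g] mult_mat_carrier[OF k, of "g ! k"]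
    by (simp add: y_def sqrt_diag_def mat_diag_mult_vec_index coeff_vec_def del: sum.lessThan_Suc)
  also have "\<dots> = sqrt (weight_of w r) * vp_resid ns d p w g r"
    using h_star_and_f2(1)[OF assms(1,2)] by (simp add: kj lsq_resid_def del: sum.lessThan_Suc)
  finally show ?thesis .
qed

text \<open>
  A vector on which the quadratic form of the normal matrix vanishes is in the kernel of the stacked
  weighted matrix, which full column rank makes trivial.
\<close>

lemma vp_pivots_of_admissible:
  assumes "admissible_data ns p w" "admissible_point ns d w g"
  shows "vp_pivots ns d w g"
proof (rule pivots_nonzero_normal_mat[OF finite_positions weight_nonneg[OF assms(1)]])
  fix x :: "nat \<Rightarrow> real"
  assume zero: "weight_of w r * (\<Sum>l<Suc d. conv_of ns d g r l * x l)\<^sup>2 = 0" if "r \<in> positions ns" for r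
  let ?A = "stacked_matrix ns d w g"
  define B where "B k = sqrt_diag (w ! k) * mult_mat d (ns ! k - d) (g ! k)" for k
  define L where "L = concat (map (\<lambda>k. rows (B k)) [0..<length ns])"
  have w: "dim_vec (w ! k) = ns ! k + 1" if "k < length ns" for k
    using assms(1) that by (auto simp: admissible_data_def)
  have B: "B k \<in> carrier_mat (ns ! k + 1) (d + 1)" if "k < length ns" for k
    unfolding B_def using w[OF that]
    by (intro mult_carrier_mat[OF _ mult_mat_carrier[OF that]]) (simp add: sqrt_diag_def mat_diag_def)
  have len: "length (rows (B k)) = ns ! k + 1" if "k < length ns" for k
    using B[OF that] by simp
  have A: "?A = mat_of_rows (d + 1) L"
    by (simp add: stacked_matrix_def stack_mats_def L_def B_def comp_def)
  then have carrier: "?A \<in> carrier_mat (length L) (d + 1)"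
    by simp
  have "?A *\<^sub>v vec (d + 1) x = 0\<^sub>v (length L)"
  proof (rule eq_vecI)
    fix i assume "i < dim_vec (0\<^sub>v (length L) :: real vec)"
    then have i: "i < length L" "i < sum_list (map Suc ns)"
      using concat_blocks(1)[where xs = "\<lambda>k. rows (B k)", OF len] by (simp_all add: L_def)
    obtain k j where kj: "stack_pos (map Suc ns) i = (k, j)"
      by fastforce
    have k: "k < length ns" and j: "j \<le> ns ! k" and Li: "L ! i = rows (B k) ! j"
      using concat_blocks(2)[where xs = "\<lambda>k. rows (B k)", OF len i(2) kj] by (simp_all add: L_def)
    have "L ! i = row (B k) j"
      using Li j len[OF k] by simp
    moreover have "row (B k) j \<in> carrier_vec (d + 1)"
      using B[OF k] row_carrier[of "B k" j] by (auto simp del: row_carrier)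
    ultimately have "row ?A i = row (B k) j"
      using i(1) unfolding A by (subst mat_of_rows_row) auto
    then have "(?A *\<^sub>v vec (d + 1) x) $ i = row (B k) j \<bullet> vec (d + 1) x"
      using i(1) by (simp add: A)
    also have "\<dots> = (B k *\<^sub>v vec (d + 1) x) $ j"
      using B[OF k] j by simp
    also have "B k *\<^sub>v vec (d + 1) x
        = sqrt_diag (w ! k) *\<^sub>v (mult_mat d (ns ! k - d) (g ! k) *\<^sub>v vec (d + 1) x)"
      unfolding B_def using mult_mat_carrier[OF k] w[OF k]
      by (intro assoc_mult_mat_vec[of _ "ns ! k + 1" "ns ! k + 1" _ "d + 1"])
        (auto simp: sqrt_diag_def mat_diag_def)
    also have "\<dots> $ j = sqrt (w ! k $ j) * (\<Sum>l<Suc d. conv_of ns d g (k, j) l * x l)"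
      using j w[OF k] mult_mat_mult_vec[OF k j, of g x] mult_mat_carrier[OF k, of "g ! k"]
      by (simp add: sqrt_diag_def mat_diag_mult_vec_index del: sum.lessThan_Suc)
    also have "\<dots> = 0"
      using zero[of "(k, j)"] k j by (auto simp: positions_def simp del: sum.lessThan_Suc)
    finally show "(?A *\<^sub>v vec (d + 1) x) $ i = 0\<^sub>v (length L) $ i"
      using i by simp
  qed (use carrier in simp)
  moreover have "vec_space.rank (length L) ?A = d + 1"
    using assms(2) carrier by (simp add: admissible_point_def)
  ultimately have "vec (d + 1) x = 0\<^sub>v (d + 1)"
    by (intro full_column_rank_mult_vec_eq_0[OF carrier]) auto
  then show "\<forall>l<Suc d. x l = 0"
    by (metis Suc_eq_plus1 index_vec index_zero_vec(1))
qed

section \<open>Evaluating the objective, the residual and their derivatives\<close>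

lemma conv_of_perturb:
  assumes "\<pi> \<in> params ns d" "length g = length ns" "r \<in> positions ns"
  shows "conv_of ns d (perturb g (fst \<pi>) (snd \<pi>) t) r l = conv_of ns d g r l + t * conv_unit \<pi> r l"
  using assms by (cases r; cases \<pi>) (auto simp: perturb_def params_def positions_def nth_list_update)

lemma eventually_pivots_perturb:
  assumes "vp_pivots ns d w g" "length g = length ns" "\<pi> \<in> params ns d"
  shows "\<forall>\<^sub>F t in nhds 0. vp_pivots ns d w (perturb g (fst \<pi>) (snd \<pi>) t)"
    and "r \<in> positions ns \<Longrightarrow> ((\<lambda>t. vp_resid ns d p w (perturb g (fst \<pi>) (snd \<pi>) t) r) has_real_derivative
      lsq_resid_deriv (Suc d) (positions ns) (weight_of w) (conv_of ns d g) (coeff_of p) (conv_unit \<pi>) r) (at 0)"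
proof -
  let ?g = "perturb g (fst \<pi>) (snd \<pi>)"
  have at_0: "?g 0 = g"
    by (simp add: perturb_def)
  have deriv: "((\<lambda>t. conv_of ns d (?g t) r l) has_real_derivative conv_unit \<pi> r l) (at 0)"
    if "r \<in> positions ns" for r l
    unfolding conv_of_perturb[OF assms(3,2) that]
    by (auto intro!: derivative_eq_intros)
  show "\<forall>\<^sub>F t in nhds 0. vp_pivots ns d w (?g t)"
    using eventually_normal_pivots_nonzero[of "positions ns" "Suc d" "\<lambda>t. conv_of ns d (?g t)" "conv_unit \<pi>" 0 "weight_of w"]
      deriv assms(1) finite_positions at_0 by simp
  show "((\<lambda>t. vp_resid ns d p w (?g t) r) has_real_derivative
      lsq_resid_deriv (Suc d) (positions ns) (weight_of w) (conv_of ns d g) (coeff_of p) (conv_unit \<pi>) r) (at 0)"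
    if "r \<in> positions ns"
    using lsq_resid_has_derivative[of "positions ns" "Suc d" "\<lambda>t. conv_of ns d (?g t)" "conv_unit \<pi>" 0 "weight_of w" r "coeff_of p"]
      deriv assms(1) finite_positions at_0 that by simp
qed

text \<open>
  The inputs at which a program has to be correct. The functions below read the least squares problem
  off an arbitrary assignment of inputs.
\<close>

definition envs :: "(vp_input \<Rightarrow> real) set" where
  "envs = {input_env p w g | p w g. admissible_data ns p w \<and> admissible_point ns d w g}"

definition env_weight :: "(vp_input \<Rightarrow> real) \<Rightarrow> nat \<times> nat \<Rightarrow> real" where
  "env_weight e = (\<lambda>(k, i). e (In_w k i))"

definition env_coeff :: "(vp_input \<Rightarrow> real) \<Rightarrow> nat \<times> nat \<Rightarrow> real" where
  "env_coeff e = (\<lambda>(k, i). e (In_p k i))"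

definition env_conv :: "(vp_input \<Rightarrow> real) \<Rightarrow> nat \<times> nat \<Rightarrow> nat \<Rightarrow> real" where
  "env_conv e = conv_entry ns d (\<lambda>k c. e (In_g k c))"

lemma env_input_env [simp]:
  "env_weight (input_env p w g) = weight_of w"
  "env_coeff (input_env p w g) = coeff_of p"
  "env_conv (input_env p w g) = conv_of ns d g"
  by (auto simp: env_weight_def env_coeff_def env_conv_def)

definition window :: "((nat \<times> nat) \<times> nat) set" where
  "window = {((k, i), l). l \<le> i \<and> i - l \<le> ns ! k - d}"

lemma finite_params: "finite (params ns d)"
  by (auto simp: params_def)

lemma degree_less_card_params:
  assumes "k < length ns"
  shows "ns ! k - d < card (params ns d)"
proof -
  have "card ({k} \<times> {..ns ! k - d}) \<le> card (params ns d)"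
    using assms by (intro card_mono finite_params) (auto simp: params_def)
  then show ?thesis
    by (simp add: card_cartesian_product)
qed

text \<open>
  In block k, column l of the matrix vanishes outside the rows l, \<dots>, l + n_k - d.
  Rows, columns and bandwidth are therefore bounded by the number of parameters, which is the sum of
  all n_k - d + 1.
\<close>

lemma sparse_lsq_envs:
  assumes "ns \<noteq> []"
  shows "sparse_lsq envs (positions ns) (Suc d) (card (params ns d)) window
    env_weight env_coeff env_conv (params ns d) conv_unit"
proof
  show "Suc d \<le> card (positions ns)"
  proof -
    have "card ({0::nat} \<times> {..d}) \<le> card (positions ns)"
      using assms d_le[of 0] by (intro card_mono finite_positions) (auto simp: positions_def)
    then show ?thesis
      by (simp add: card_cartesian_product)
  qed
  show "positions ns \<noteq> {}"
    using assms by (auto simp: positions_def)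
  show "1 \<le> card (params ns d)"
    using degree_less_card_params[of 0] assms by simp
  show "card {r \<in> positions ns. (r, j) \<in> window} \<le> card (params ns d)" if "j < Suc d" for j
    by (rule card_inj_on_le[where f = "\<lambda>(k, i). (k, i - j)"])
      (auto simp: inj_on_def window_def positions_def params_def finite_params)
  show "card {l. l < Suc d \<and> (r, l) \<in> window} \<le> card (params ns d)" if "r \<in> positions ns" for r
    using that by (intro card_inj_on_le[where f = "\<lambda>l. (fst r, snd r - l)"])
      (auto simp: inj_on_def window_def positions_def params_def finite_params)
  show "j < l + card (params ns d)"
    if "r \<in> positions ns" "(r, j) \<in> window" "(r, l) \<in> window" for r j l
    using that degree_less_card_params[of "fst r"] by (auto simp: window_def positions_def)
  show "env_conv e r l = 0" if "(r, l) \<notin> window" for e r l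
    using that by (cases r) (auto simp: env_conv_def window_def)
  show "conv_unit \<pi> r l = 0" if "\<pi> \<in> params ns d" "(r, l) \<notin> window" for \<pi> r l
    using that by (cases r; cases \<pi>) (auto simp: window_def params_def)
  show "card {l. l < Suc d \<and> conv_unit \<pi> r l \<noteq> 0} \<le> 1" for \<pi> r
  proof -
    have "{l. l < Suc d \<and> conv_unit \<pi> r l \<noteq> 0} \<subseteq> {snd r - snd \<pi>}"
      by (cases r; cases \<pi>) auto
    then show ?thesis
      using card_mono[of "{snd r - snd \<pi>}"] by fastforce
  qed
  show "conv_unit \<pi> r l \<in> \<int>" for \<pi> r l
    by (cases r; cases \<pi>) auto
  show "computes envs F 0 {\<lambda>e. env_weight e r}" for F r
    by (cases r) (auto simp: env_weight_def computes_Input)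
  show "computes envs F 0 {\<lambda>e. env_coeff e r}" for F r
    by (cases r) (auto simp: env_coeff_def computes_Input)
  show "computes envs F 0 {\<lambda>e. env_conv e r l}" for F r l
  proof (cases r)
    case (Pair k i)
    show ?thesis
      by (cases "l \<le> i \<and> i - l \<le> ns ! k - d")
        (simp_all only: Pair env_conv_def conv_entry.simps if_True if_False simp_thms computes_Input computes_zero)
  qed
  show "env_weight e r \<ge> 0" if e: "e \<in> envs" and r: "r \<in> positions ns" for e r
  proof -
    obtain p w g where "e = input_env p w g" "admissible_data ns p w"
      using e by (auto simp: envs_def)
    then show ?thesis
      using weight_nonneg[OF _ r] by simp
  qed
  show "pivots_nonzero (Suc d) (normal_mat (positions ns) (env_weight e) (env_conv e))"
    if e: "e \<in> envs" for e
  proof -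
    obtain p w g where "e = input_env p w g" "admissible_data ns p w" "admissible_point ns d w g"
      using e by (auto simp: envs_def)
    then show ?thesis
      using vp_pivots_of_admissible by simp
  qed
qed (rule finite_positions finite_params order_refl)+

abbreviation gstar_entry :: "(vp_input \<Rightarrow> real) \<Rightarrow> nat \<times> nat \<Rightarrow> real" where
  "gstar_entry e r \<equiv> sqrt (env_weight e r) *
     lsq_resid (Suc d) (positions ns) (env_weight e) (env_conv e) (env_coeff e) r"

abbreviation jac_entry :: "(vp_input \<Rightarrow> real) \<Rightarrow> nat \<times> nat \<Rightarrow> nat \<times> nat \<Rightarrow> real" where
  "jac_entry e \<pi> r \<equiv> sqrt (env_weight e r) *
     lsq_resid_deriv (Suc d) (positions ns) (env_weight e) (env_conv e) (env_coeff e) (conv_unit \<pi>) r"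

text \<open>
  Indices outside the required range are given the constant 0, as a program assigns an operand to
  every output.
\<close>

fun output_value :: "vp_output \<Rightarrow> (vp_input \<Rightarrow> real) \<Rightarrow> real" where
  "output_value Out_f2 = (\<lambda>e. \<Sum>r\<in>positions ns. gstar_entry e r * gstar_entry e r)"
| "output_value (Out_grad k j) = (if (k, j) \<in> params ns d
     then (\<lambda>e. 2 * (\<Sum>r\<in>positions ns. gstar_entry e r * jac_entry e (k, j) r)) else (\<lambda>e. 0))"
| "output_value (Out_gstar i) = (if i < sum_list (map Suc ns)
     then (\<lambda>e. gstar_entry e (stack_pos (map Suc ns) i)) else (\<lambda>e. 0))"
| "output_value (Out_jac i k j) = (if i < sum_list (map Suc ns) \<and> (k, j) \<in> params ns d
     then (\<lambda>e. jac_entry e (k, j) (stack_pos (map Suc ns) i)) else (\<lambda>e. 0))"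

lemma computes_outputs:
  assumes "ns \<noteq> []"
  shows "computes envs {} (60 * (card (params ns d))\<^sup>2 * card (positions ns)) (range output_value)"
proof -
  interpret sparse_lsq envs "positions ns" "Suc d" "card (params ns d)" window
    env_weight env_coeff env_conv "params ns d" conv_unit
    by (rule sparse_lsq_envs[OF assms])
  have "output_value out \<in> vals_y \<union> vals_y' \<union>
     ({\<lambda>e. \<Sum>r\<in>positions ns. y e r * y e r} \<union>
      (\<lambda>\<pi> e. 2 * (\<Sum>r\<in>positions ns. y e r * y' e \<pi> r)) ` params ns d) \<union> {\<lambda>e. 0}" for out
    using stack_pos_in_positions
    by (cases out) (auto simp: vals_y_def vals_y'_def image_iff)
  then show ?thesis
    by (intro computes_mono[OF computes_Un[OF computes_all computes_zero[of _ _ 0]]] image_subsetI)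
      simp_all
qed

text \<open>
  The formulas for f2 and g_star hold wherever the pivots do not vanish, in particular at all points near
  an admissible one. They can therefore be differentiated there.
\<close>

lemma output_value_correct:
  assumes "admissible_data ns p w" "admissible_point ns d w g"
  defines "e \<equiv> input_env p w g"
  shows "output_value Out_f2 e = f2 ns d p w g"
    and "(k, j) \<in> params ns d \<Longrightarrow>
      ((\<lambda>t. f2 ns d p w (perturb g k j t)) has_real_derivative output_value (Out_grad k j) e) (at 0)"
    and "i < sum_list (map Suc ns) \<Longrightarrow> output_value (Out_gstar i) e = g_star ns d p w g $ i"
    and "i < sum_list (map Suc ns) \<Longrightarrow> (k, j) \<in> params ns d \<Longrightarrow>
      ((\<lambda>t. g_star ns d p w (perturb g k j t) $ i) has_real_derivative output_value (Out_jac i k j) e) (at 0)"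
proof -
  have piv: "vp_pivots ns d w g"
    by (rule vp_pivots_of_admissible[OF assms(1,2)])
  have len: "length g = length ns"
    using assms(2) by (simp add: admissible_point_def)
  let ?y = "\<lambda>g r. sqrt (weight_of w r) * vp_resid ns d p w g r"
  have f2: "f2 ns d p w g = (\<Sum>r\<in>positions ns. ?y g r * ?y g r)" if "vp_pivots ns d w g" for g
  proof -
    have "weight_of w r * (vp_resid ns d p w g r)\<^sup>2 = ?y g r * ?y g r" if "r \<in> positions ns" for r
    proof -
      have "?y g r * ?y g r = sqrt (weight_of w r) * sqrt (weight_of w r) * (vp_resid ns d p w g r)\<^sup>2"
        by (simp only: power2_eq_square mult_ac)
      also have "sqrt (weight_of w r) * sqrt (weight_of w r) = weight_of w r"
        by (rule real_sqrt_mult_self[THEN trans, OF abs_of_nonneg[OF weight_nonneg[OF assms(1) that]]])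
      finally show ?thesis ..
    qed
    then show ?thesis
      unfolding h_star_and_f2(2)[OF assms(1) that] by (intro sum.cong refl)
  qed
  show "output_value Out_f2 e = f2 ns d p w g"
    by (simp add: f2[OF piv] e_def)
  show "output_value (Out_gstar i) e = g_star ns d p w g $ i" if "i < sum_list (map Suc ns)"
    using that by (simp add: g_star_index[OF assms(1) piv that] e_def)
  have y': "((\<lambda>t. ?y (perturb g k j t) r) has_real_derivative jac_entry e (k, j) r) (at 0)"
    if "(k, j) \<in> params ns d" "r \<in> positions ns" for k j r
    using eventually_pivots_perturb(2)[OF piv len that]
    by (auto simp: e_def intro!: DERIV_cmult)
  have ev: "\<forall>\<^sub>F t in nhds 0. vp_pivots ns d w (perturb g k j t)" if "(k, j) \<in> params ns d"
    using eventually_pivots_perturb(1)[OF piv len that] by simp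
  have at_0: "perturb g k j 0 = g"
    by (simp add: perturb_def)
  show "((\<lambda>t. f2 ns d p w (perturb g k j t)) has_real_derivative output_value (Out_grad k j) e) (at 0)"
    if kj: "(k, j) \<in> params ns d"
  proof -
    have "((\<lambda>t. \<Sum>r\<in>positions ns. ?y (perturb g k j t) r * ?y (perturb g k j t) r) has_real_derivative
        (\<Sum>r\<in>positions ns. jac_entry e (k, j) r * ?y (perturb g k j 0) r
          + jac_entry e (k, j) r * ?y (perturb g k j 0) r)) (at 0)"
      by (intro DERIV_sum DERIV_mult y' kj)
    also have "(\<Sum>r\<in>positions ns. jac_entry e (k, j) r * ?y (perturb g k j 0) r
          + jac_entry e (k, j) r * ?y (perturb g k j 0) r) = output_value (Out_grad k j) e"
      using kj by (simp add: at_0 e_def sum_distrib_left mult_ac)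
    finally show ?thesis
      using ev[OF kj] by (subst DERIV_cong_ev[OF refl _ refl]) (auto elim!: eventually_mono simp: f2)
  qed
  show "((\<lambda>t. g_star ns d p w (perturb g k j t) $ i) has_real_derivative output_value (Out_jac i k j) e) (at 0)"
    if i: "i < sum_list (map Suc ns)" and kj: "(k, j) \<in> params ns d"
  proof -
    have "((\<lambda>t. ?y (perturb g k j t) (stack_pos (map Suc ns) i)) has_real_derivative
        output_value (Out_jac i k j) e) (at 0)"
      using y'[OF kj stack_pos_in_positions[OF i]] i kj by simp
    then show ?thesis
      using ev[OF kj]
      by (subst DERIV_cong_ev[OF refl _ refl])
        (auto elim!: eventually_mono simp: g_star_index[OF assms(1) _ i])
  qed
qed

lemma evaluates_in_flops:
  assumes "ns \<noteq> []"
  shows "\<exists>P. evaluates ns d P \<and> flops P \<le> 60 * (card (params ns d))\<^sup>2 * card (positions ns)"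
proof -
  obtain P :: "(vp_input, vp_output) slp" where P: "flops P \<le> 60 * (card (params ns d))\<^sup>2 * card (positions ns)"
    "\<And>e out. e \<in> envs \<Longrightarrow> slp_output P e out = Some (output_value out e)"
    using slp_of_computes[OF computes_outputs[OF assms]] by blast
  have "evaluates ns d P"
    unfolding evaluates_def
  proof (intro allI impI)
    fix p w g assume adm: "admissible_data ns p w" "admissible_point ns d w g"
    then have "slp_output P (input_env p w g) out = Some (output_value out (input_env p w g))" for out
      by (intro P(2)) (auto simp: envs_def)
    moreover have "(k, j) \<in> params ns d" if "k < length ns" "j \<le> ns ! k - d" for k j
      using that by (auto simp: params_def)
    ultimately show "slp_output P (input_env p w g) Out_f2 = Some (f2 ns d p w g) \<and>
        (\<forall>k<length ns. \<forall>j\<le>ns ! k - d. \<exists>D.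
           slp_output P (input_env p w g) (Out_grad k j) = Some D \<and>
           ((\<lambda>t. f2 ns d p w (perturb g k j t)) has_real_derivative D) (at 0)) \<and>
        (\<forall>i<dim_vec (g_star ns d p w g).
           slp_output P (input_env p w g) (Out_gstar i) = Some (g_star ns d p w g $ i)) \<and>
        (\<forall>i<dim_vec (g_star ns d p w g). \<forall>k<length ns. \<forall>j\<le>ns ! k - d. \<exists>D.
           slp_output P (input_env p w g) (Out_jac i k j) = Some D \<and>
           ((\<lambda>t. g_star ns d p w (perturb g k j t) $ i) has_real_derivative D) (at 0))"
      using output_value_correct[OF adm] unfolding dim_g_star[OF adm(1)]
      by (simp del: output_value.simps)
  qed
  with P(1) show ?thesis
    by blast
qed

lemma card_params: "real (card (params ns d)) = excess ns d + length ns"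
proof -
  have "real (card (params ns d)) = (\<Sum>k<length ns. real (ns ! k) - real d + 1)"
    using d_le by (simp add: params_def)
  then show ?thesis
    by (simp add: excess_def sum.distrib sum_subtractf sum_list_sum_nth atLeast0LessThan)
qed

end

section \<open>The asymptotic flop count\<close>

theorem corollary6p10:
  shows "\<exists>alg :: nat list \<Rightarrow> nat \<Rightarrow> (vp_input, vp_output) slp.
    (\<forall>ns d. ns \<noteq> [] \<longrightarrow> d \<le> Min (set ns) \<longrightarrow> evaluates ns d (alg ns d)) \<and>
    (\<lambda>(ns, d). real (flops (alg ns d)))
      \<in> O[principal {(ns, d). ns \<noteq> [] \<and> d < Min (set ns)}](
           \<lambda>(ns, d). (excess ns d)\<^sup>2 * real (sum_list ns)) \<and>
    (\<forall>N\<ge>1. (\<lambda>(ns, d). real (flops (alg ns d)))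
      \<in> O[principal {(ns, d). length ns = N \<and> d \<le> Min (set ns)}](
           \<lambda>(ns, d). (max 1 (excess ns d))\<^sup>2 * max 1 (real (sum_list ns))))"
proof -
  have nth: "d \<le> ns ! k" if "d \<le> Min (set ns)" "k < length ns" for ns :: "nat list" and d k
    using that Min_le[of "set ns" "ns ! k"] by (meson List.finite_set le_trans nth_mem)
  have "\<exists>P. ns \<noteq> [] \<longrightarrow> d \<le> Min (set ns) \<longrightarrow> evaluates ns d P \<and>
      flops P \<le> 60 * (card (params ns d))\<^sup>2 * card (positions ns)" for ns d
    using evaluates_in_flops[OF nth] by blast
  then obtain alg :: "nat list \<Rightarrow> nat \<Rightarrow> (vp_input, vp_output) slp" where
    alg: "\<And>ns d. ns \<noteq> [] \<Longrightarrow> d \<le> Min (set ns) \<Longrightarrow> evaluates ns d (alg ns d)"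
    and fl: "\<And>ns d. ns \<noteq> [] \<Longrightarrow> d \<le> Min (set ns) \<Longrightarrow>
      flops (alg ns d) \<le> 60 * (card (params ns d))\<^sup>2 * card (positions ns)"
    by metis
  have bound: "real (flops (alg ns d)) \<le> 60 * (excess ns d + length ns)\<^sup>2 * (real (sum_list ns) + length ns)"
    if "ns \<noteq> []" "d \<le> Min (set ns)" for ns d
  proof -
    have "real (flops (alg ns d)) \<le> real (60 * (card (params ns d))\<^sup>2 * card (positions ns))"
      using fl[OF that] by (simp only: of_nat_le_iff)
    then show ?thesis
      by (simp add: card_params[OF nth[OF that(2)]] card_positions)
  qed
  have excess_ge: "real (length ns) * c \<le> excess ns d" if "\<And>k. k < length ns \<Longrightarrow> real d + c \<le> ns ! k" for ns d c
  proof -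
    have "(\<Sum>k<length ns. c) \<le> (\<Sum>k<length ns. real (ns ! k) - real d)"
      using that by (intro sum_mono) (simp add: algebra_simps)
    then show ?thesis
      by (simp add: excess_def sum_subtractf sum_list_sum_nth atLeast0LessThan)
  qed
  have "(\<lambda>(ns, d). real (flops (alg ns d)))
      \<in> O[principal {(ns, d). ns \<noteq> [] \<and> d < Min (set ns)}](
           \<lambda>(ns, d). (excess ns d)\<^sup>2 * real (sum_list ns))"
  proof (rule bigoI[where c = 480], unfold eventually_principal, safe)
    fix ns :: "nat list" and d assume *: "ns \<noteq> []" "d < Min (set ns)"
    have "d + 1 \<le> ns ! k" if "k < length ns" for k
      using nth[OF Suc_leI[OF *(2)] that] by simp
    then have "real d + 1 \<le> ns ! k" if "k < length ns" for k
      using that by fastforce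
    \<comment> \<open>Every block contributes at least 1 to the excess, so the number of blocks is absorbed by it.\<close>
    then have N: "real (length ns) \<le> excess ns d"
      using excess_ge[of ns d 1] by simp
    moreover have "excess ns d \<le> real (sum_list ns)"
      by (simp add: excess_def)
    ultimately have "60 * (excess ns d + length ns)\<^sup>2 * (real (sum_list ns) + length ns)
        \<le> 60 * (2 * excess ns d)\<^sup>2 * (2 * real (sum_list ns))"
      by (intro mult_mono power_mono) auto
    also have "\<dots> = 480 * ((excess ns d)\<^sup>2 * real (sum_list ns))"
      by (simp add: power_mult_distrib)
    finally have "real (flops (alg ns d)) \<le> 480 * ((excess ns d)\<^sup>2 * real (sum_list ns))"
      using bound[OF *(1) less_imp_le[OF *(2)]] by linarith
    then show "norm (real (flops (alg ns d))) \<le> 480 * norm ((excess ns d)\<^sup>2 * real (sum_list ns))"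
      by (simp add: abs_mult)
  qed
  moreover have "(\<lambda>(ns, d). real (flops (alg ns d)))
      \<in> O[principal {(ns, d). length ns = N \<and> d \<le> Min (set ns)}](
           \<lambda>(ns, d). (max 1 (excess ns d))\<^sup>2 * max 1 (real (sum_list ns)))" if "N \<ge> 1" for N
  proof (rule bigoI[where c = "60 * (1 + real N) ^ 3"], unfold eventually_principal, safe)
    fix ns :: "nat list" and d assume *: "N = length ns" "d \<le> Min (set ns)"
    let ?a = "max 1 (excess ns d)" and ?b = "max 1 (real (sum_list ns))"
    have "0 \<le> excess ns d"
      using excess_ge[of ns d 0] nth[OF *(2)] by simp
    moreover have "excess ns d + real N \<le> (1 + real N) * ?a" "real (sum_list ns) + real N \<le> (1 + real N) * ?b"
      using mult_left_mono[of 1 ?a "real N"] mult_left_mono[of 1 ?b "real N"]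
      by (simp_all add: distrib_right)
    ultimately have "60 * (excess ns d + N)\<^sup>2 * (real (sum_list ns) + N)
        \<le> 60 * ((1 + real N) * ?a)\<^sup>2 * ((1 + real N) * ?b)"
      by (intro mult_mono power_mono) auto
    also have "\<dots> = 60 * (1 + real N) ^ 3 * (?a\<^sup>2 * ?b)"
      by (simp add: power_mult_distrib power2_eq_square power3_eq_cube)
    finally have "real (flops (alg ns d)) \<le> 60 * (1 + real N) ^ 3 * (?a\<^sup>2 * ?b)"
      using bound[OF _ *(2)] *(1) that by fastforce
    then show "norm (real (flops (alg ns d))) \<le> 60 * (1 + real (length ns)) ^ 3 * norm (?a\<^sup>2 * ?b)"
      using *(1) by (simp add: abs_mult)
  qed
  ultimately show ?thesis
    using alg by blast
qed

end
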